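(* For every $K>0$ and $\delta\in(0,1/2]$ there is a constant $C=C(K,\delta)>0$ such that the following holds. Let $n\ge2$ and $1\le k\le n-1$ be integers with $\delta\le k/n\le1-\delta$, let $\mu$ be the uniform probability measure on $\binom{[n]}{k}$, and let $f:\binom{[n]}{k}\to\mathbb{R}$ satisfy $\mathrm{Inf}(f)\le K$. Then for every $\varepsilon\in(0,1/2]$ there exists a function $g:\binom{[n]}{k}\to\mathbb{R}$ depending on at most $\exp\left(C\,\frac{|\log\varepsilon|}{\varepsilon}\right)$ coordinates such that $\|f-g\|_{L^1(\mu)}\le\varepsilon$.
   Context: $[n]=\{1,\dots,n\}$ and $\binom{[n]}{k}=\{x\in\{0,1\}^n:\sum_{i=1}^n x_i=k\}$ (a slice of the Boolean cube). For $1\le i<j\le n$, $x^{\tau_{ij}}$ is obtained from $x$ by switching the coordinates $i$ and $j$; $D_{\tau_{ij}}f(x)=f(x^{\tau_{ij}})-f(x)$ and $I_{\tau_{ij}}(f)=\|D_{\tau_{ij}}f\|_{L^1(\mu)}$. The total influence is $\mathrm{Inf}(f)=\frac1n\sum_{1\le i<j\le n}I_{\tau_{ij}}(f)$. A function $g$ on the slice depends only on the coordinates of a subset $S\subset[n]$ if $I_{\tau_{ij}}(g)=0$ whenever $i,j\notin S$; it depends on at most $m$ coordinates (is an $m$-junta) if such an $S$ exists with $|S|\le m$. *)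

theory Defs
  imports "HOL-Probability.Probability" "HOL-Combinatorics.Transposition"
begin

(* Points are extensional functions on {1..n} (value undefined elsewhere), so that the
   slice is a finite set with exactly n choose k elements. *)
definition slice :: "nat \<Rightarrow> nat \<Rightarrow> (nat \<Rightarrow> nat) set" where
  "slice n k = {x \<in> {1..n} \<rightarrow>\<^sub>E {0, 1}. (\<Sum>i = 1..n. x i) = k}"

definition slice_measure :: "nat \<Rightarrow> nat \<Rightarrow> (nat \<Rightarrow> nat) measure" where
  "slice_measure n k = uniform_count_measure (slice n k)"

(* Functions on the slice are total HOL functions; only their values on the slice,
   which is the space of the measure, enter any of the notions below. *)
definition L1_norm :: "nat \<Rightarrow> nat \<Rightarrow> ((nat \<Rightarrow> nat) \<Rightarrow> real) \<Rightarrow> real" where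
  "L1_norm n k f = (\<integral>x. \<bar>f x\<bar> \<partial>slice_measure n k)"

definition switch :: "nat \<Rightarrow> nat \<Rightarrow> (nat \<Rightarrow> nat) \<Rightarrow> (nat \<Rightarrow> nat)" where
  "switch i j x = x \<circ> Transposition.transpose i j"

definition D_switch :: "nat \<Rightarrow> nat \<Rightarrow> ((nat \<Rightarrow> nat) \<Rightarrow> real) \<Rightarrow> (nat \<Rightarrow> nat) \<Rightarrow> real" where
  "D_switch i j f x = f (switch i j x) - f x"

definition influence :: "nat \<Rightarrow> nat \<Rightarrow> nat \<Rightarrow> nat \<Rightarrow> ((nat \<Rightarrow> nat) \<Rightarrow> real) \<Rightarrow> real" where
  "influence n k i j f = L1_norm n k (D_switch i j f)"

definition total_influence :: "nat \<Rightarrow> nat \<Rightarrow> ((nat \<Rightarrow> nat) \<Rightarrow> real) \<Rightarrow> real" where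
  "total_influence n k f = 1 / real n * (\<Sum>j = 1..n. \<Sum>i = 1..<j. influence n k i j f)"

definition depends_only_on :: "nat \<Rightarrow> nat \<Rightarrow> nat set \<Rightarrow> ((nat \<Rightarrow> nat) \<Rightarrow> real) \<Rightarrow> bool" where
  "depends_only_on n k S g \<longleftrightarrow>
     (\<forall>i j. 1 \<le> i \<and> i < j \<and> j \<le> n \<and> i \<notin> S \<and> j \<notin> S \<longrightarrow> influence n k i j g = 0)"

(* The bound m is real because it is instantiated with values of exp. *)
definition junta :: "nat \<Rightarrow> nat \<Rightarrow> real \<Rightarrow> ((nat \<Rightarrow> nat) \<Rightarrow> real) \<Rightarrow> bool" where
  "junta n k m g \<longleftrightarrow> (\<exists>S \<subseteq> {1..n}. real (card S) \<le> m \<and> depends_only_on n k S g)"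

lemma switch_in_slice:
  assumes "i \<in> {1..n}" "j \<in> {1..n}" "x \<in> slice n k"
  shows "switch i j x \<in> slice n k"
proof -
  have b: "bij_betw (Transposition.transpose i j) {1..n} {1..n}"
    using assms(1,2) by (simp add: bij_betw_def)
  have "(\<Sum>l = 1..n. x (Transposition.transpose i j l)) = (\<Sum>l = 1..n. x l)"
    by (rule sum.reindex_bij_betw[OF b])
  moreover have "x \<circ> Transposition.transpose i j \<in> {1..n} \<rightarrow>\<^sub>E {0, 1}"
  proof (rule PiE_I)
    fix l assume "l \<in> {1..n}"
    then have "Transposition.transpose i j l \<in> {1..n}"
      using b bij_betwE by blast
    then show "(x \<circ> Transposition.transpose i j) l \<in> {0, 1}"
      using assms(3) by (auto simp: slice_def PiE_iff)
  next
    fix l assume l: "l \<notin> {1..n}"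
    then have "Transposition.transpose i j l = l"
      using assms(1,2) by (metis transpose_apply_other)
    then show "(x \<circ> Transposition.transpose i j) l = undefined"
      using assms(3) l by (auto simp: slice_def PiE_iff extensional_def)
  qed
  ultimately show ?thesis
    using assms(3) by (simp add: slice_def switch_def)
qed

lemma finite_slice: "finite (slice n k)"
proof -
  have "finite ({1..n} \<rightarrow>\<^sub>E {0, 1::nat})"
    by (intro finite_PiE) auto
  then show ?thesis by (simp add: slice_def)
qed

lemma slice_nonempty:
  assumes "k \<le> n"
  shows "slice n k \<noteq> {}"
proof -
  define x where "x = restrict (\<lambda>i. if i \<le> k then 1 else 0::nat) {1..n}"
  have "(\<Sum>i = 1..n. x i) = (\<Sum>i = 1..n. if i \<le> k then 1 else 0)"
    by (intro sum.cong) (auto simp: x_def)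
  also have "\<dots> = card ({1..n} \<inter> {i. i \<le> k})"
    by (simp add: sum.If_cases)
  also have "{1..n} \<inter> {i. i \<le> k} = {1..k}"
    using assms by auto
  finally have "(\<Sum>i = 1..n. x i) = k" by simp
  moreover have "x \<in> {1..n} \<rightarrow>\<^sub>E {0, 1}"
    by (auto simp: x_def)
  ultimately show ?thesis by (auto simp: slice_def)
qed

lemma prob_space_slice_measure:
  assumes "k \<le> n"
  shows "prob_space (slice_measure n k)"
  unfolding slice_measure_def
  using finite_slice slice_nonempty[OF assms] by (rule prob_space_uniform_count_measure)

end

theory Submission imports Defs begin

text \<open>
  Let T be one lazy random transposition. It commutes with all difference operators, moves f by at
  most Inf(f)/n in L1, and the log-Sobolev inequality of the slice, applied to a function u with
  small L1 norm, forces the L2 norm of its iterates down at a geometric rate in the exponent. Hence,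
  after about \<open>\<epsilon> n\<close> steps, the differences in directions i, j of small influence are
  tiny in L2, and by the Poincare inequality the iterate is close to its conditional expectation
  given the set S of influential coordinates.

  Because f is unbounded, this is applied to the dyadic layers of its positive and negative parts.
  On a layer of height L the L2 error is of order L, but the layer lives on a set of measure O(1/L);
  rounding small values of the conditional expectation to 0 keeps the approximant on such a set
  too, and the errors of the layers add up to a multiple of the total influence and the L1 norm.
\<close>

section \<open>Functional inequalities on slices\<close>

text \<open>The form of the bound comes from a trade-off. A direction whose influence is at most
  \<rho> gains a factor \<open>\<rho> powr \<beta>\<close> with
  \<open>\<beta> = 1 - (1 - rate) ^ m\<close>. For fixed \<delta> the rate has order 1/n, so \<beta>
  has order m/n; but m steps also cost m/n times the total influence in L1. An error \<epsilon> thus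
  allows only \<beta> of order \<epsilon>, and pushing \<open>\<rho> powr \<beta>\<close> down to a
  power of \<epsilon> forces \<rho> = exp(-C |log \<epsilon>| / \<epsilon>), with about 1/\<rho>
  influential coordinates. Two points need care. In the L2 bound for a smoothed difference one
  factor of the influence itself is kept beside the power of \<rho>, so that summing over all pairs
  i, j restores the total influence instead of counting pairs. And influence belongs to pairs, not
  to coordinates, so S has to be read off from row sums of the influence matrix. Points are encoded
  as subsets of an arbitrary finite set because the functional inequalities are proved by induction:
  fixing whether one element belongs to X leaves a slice over a smaller ground set.\<close>

definition ksub :: "'a set \<Rightarrow> nat \<Rightarrow> 'a set set" where
  "ksub N k = {X. X \<subseteq> N \<and> card X = k}"

lemma finite_ksub [simp]: "finite N \<Longrightarrow> finite (ksub N k)"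
  unfolding ksub_def by (rule finite_subset[of _ "Pow N"]) auto

lemma card_ksub: "finite N \<Longrightarrow> card (ksub N k) = card N choose k"
  unfolding ksub_def by (rule n_subsets)

lemma finite_of_ksub: "finite N \<Longrightarrow> X \<in> ksub N k \<Longrightarrow> finite X"
  unfolding ksub_def by (auto intro: finite_subset)

section \<open>Double counting of sets, elements and edges\<close>

lemma sum_ksub_insert:
  assumes "finite N"
  shows "(\<Sum>i\<in>N. \<Sum>Y\<in>ksub (N - {i}) r. h i (insert i Y)) = (\<Sum>Z\<in>ksub N (Suc r). \<Sum>i\<in>Z. h i Z)"
proof -
  have "(\<Sum>i\<in>N. \<Sum>Y\<in>ksub (N - {i}) r. h i (insert i Y))
      = (\<Sum>(i, Y)\<in>Sigma N (\<lambda>i. ksub (N - {i}) r). h i (insert i Y))"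
    using assms by (intro sum.Sigma) auto
  also have "\<dots> = (\<Sum>(Z, i)\<in>Sigma (ksub N (Suc r)) (\<lambda>Z. Z). h i Z)"
  proof (rule sum.reindex_bij_witness[of _ "\<lambda>(Z, i). (i, Z - {i})" "\<lambda>(i, Y). (insert i Y, i)"])
    fix p assume p: "p \<in> Sigma N (\<lambda>i. ksub (N - {i}) r)"
    then obtain i Y where [simp]: "p = (i, Y)" and i: "i \<in> N" "Y \<subseteq> N - {i}" "card Y = r"
      by (auto simp: ksub_def)
    have "finite Y" using assms i(2) by (meson finite_Diff finite_subset)
    moreover have "i \<notin> Y" using i by auto
    ultimately show "(case p of (i, Y) \<Rightarrow> (insert i Y, i)) \<in> Sigma (ksub N (Suc r)) (\<lambda>Z. Z)"
      using i by (auto simp: ksub_def)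
    show "(case case p of (i, Y) \<Rightarrow> (insert i Y, i) of (Z, i) \<Rightarrow> (i, Z - {i})) = p"
      using \<open>i \<notin> Y\<close> by auto
  next
    fix p assume p: "p \<in> Sigma (ksub N (Suc r)) (\<lambda>Z. Z)"
    then obtain Z i where [simp]: "p = (Z, i)" and i: "i \<in> Z" "Z \<subseteq> N" "card Z = Suc r"
      by (auto simp: ksub_def)
    have "finite Z" using assms i(2) by (meson finite_subset)
    then show "(case p of (Z, i) \<Rightarrow> (i, Z - {i})) \<in> Sigma N (\<lambda>i. ksub (N - {i}) r)"
      using i by (auto simp: ksub_def)
    show "(case case p of (Z, i) \<Rightarrow> (i, Z - {i}) of (i, Y) \<Rightarrow> (insert i Y, i)) = p"
      using i by auto
  qed auto
  also have "\<dots> = (\<Sum>Z\<in>ksub N (Suc r). \<Sum>i\<in>Z. h i Z)"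
    using assms by (intro sum.Sigma[symmetric]) (auto intro: finite_of_ksub)
  finally show ?thesis .
qed

lemma sum_ksub_remove:
  assumes "finite N"
  shows "(\<Sum>i\<in>N. \<Sum>Y\<in>ksub (N - {i}) r. h i Y) = (\<Sum>Y\<in>ksub N r. \<Sum>i\<in>N - Y. h i Y)"
proof -
  have "(\<Sum>i\<in>N. \<Sum>Y\<in>ksub (N - {i}) r. h i Y)
      = (\<Sum>(i, Y)\<in>Sigma N (\<lambda>i. ksub (N - {i}) r). h i Y)"
    using assms by (intro sum.Sigma) auto
  also have "\<dots> = (\<Sum>(Y, i)\<in>Sigma (ksub N r) (\<lambda>Y. N - Y). h i Y)"
    by (rule sum.reindex_bij_witness[of _ "\<lambda>(Y, i). (i, Y)" "\<lambda>(i, Y). (Y, i)"])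
      (auto simp: ksub_def)
  also have "\<dots> = (\<Sum>Y\<in>ksub N r. \<Sum>i\<in>N - Y. h i Y)"
    using assms by (intro sum.Sigma[symmetric]) auto
  finally show ?thesis .
qed

text \<open>Sum over the edges of the Johnson graph on sets of size r + 1. An edge is indexed by the
  common part Y of its endpoints, so each is met in both orders; the diagonal a = b is harmless once
  \<psi> vanishes there.\<close>

definition edge_sum ::
  "(real \<Rightarrow> real \<Rightarrow> real) \<Rightarrow> 'a set \<Rightarrow> nat \<Rightarrow> ('a set \<Rightarrow> real) \<Rightarrow> real" where
  "edge_sum \<psi> N r f = (\<Sum>Y\<in>ksub N r. \<Sum>a\<in>N - Y. \<Sum>b\<in>N - Y. \<psi> (f (insert a Y)) (f (insert b Y)))"

lemma edge_sum_nonneg: "(\<And>u v. 0 \<le> \<psi> u v) \<Longrightarrow> 0 \<le> edge_sum \<psi> N r f"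
  unfolding edge_sum_def by (intro sum_nonneg) auto

lemma sum_edge_sum_insert:
  assumes "finite N"
  shows "(\<Sum>i\<in>N. edge_sum \<psi> (N - {i}) r (\<lambda>Y. f (insert i Y))) = real (Suc r) * edge_sum \<psi> N (Suc r) f"
proof -
  define H where "H Z = (\<Sum>a\<in>N - Z. \<Sum>b\<in>N - Z. \<psi> (f (insert a Z)) (f (insert b Z)))" for Z
  have "(\<Sum>i\<in>N. edge_sum \<psi> (N - {i}) r (\<lambda>Y. f (insert i Y)))
      = (\<Sum>i\<in>N. \<Sum>Y\<in>ksub (N - {i}) r. H (insert i Y))"
    unfolding edge_sum_def H_def
    by (intro sum.cong refl) (auto simp: insert_commute intro!: sum.cong)
  also have "\<dots> = (\<Sum>Z\<in>ksub N (Suc r). \<Sum>i\<in>Z. H Z)"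
    by (rule sum_ksub_insert[OF assms])
  also have "\<dots> = (\<Sum>Z\<in>ksub N (Suc r). real (Suc r) * H Z)"
    by (intro sum.cong refl) (auto simp: ksub_def)
  also have "\<dots> = real (Suc r) * edge_sum \<psi> N (Suc r) f"
    by (simp add: edge_sum_def H_def sum_distrib_left)
  finally show ?thesis .
qed

lemma sum_pairs_remove:
  fixes q :: "'a \<Rightarrow> 'a \<Rightarrow> real"
  assumes "finite M" "\<And>a. q a a = 0"
  shows "(\<Sum>i\<in>M. \<Sum>a\<in>M - {i}. \<Sum>b\<in>M - {i}. q a b) = (real (card M) - 2) * (\<Sum>a\<in>M. \<Sum>b\<in>M. q a b)"
proof -
  have "(\<Sum>a\<in>M - {i}. \<Sum>b\<in>M - {i}. q a b)
      = (\<Sum>a\<in>M. \<Sum>b\<in>M. q a b) - (\<Sum>b\<in>M. q i b) - (\<Sum>a\<in>M. q a i)" if "i \<in> M" for i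
    using that assms by (simp add: sum_diff1 sum_subtractf)
  then have "(\<Sum>i\<in>M. \<Sum>a\<in>M - {i}. \<Sum>b\<in>M - {i}. q a b)
      = (\<Sum>i\<in>M. (\<Sum>a\<in>M. \<Sum>b\<in>M. q a b) - (\<Sum>b\<in>M. q i b) - (\<Sum>a\<in>M. q a i))"
    by (rule sum.cong[OF refl])
  also have "\<dots> = (real (card M) - 2) * (\<Sum>a\<in>M. \<Sum>b\<in>M. q a b)"
    using sum.swap[of "\<lambda>i a. q a i" M M] by (simp add: sum_subtractf sum.distrib algebra_simps)
  finally show ?thesis .
qed

lemma sum_edge_sum_remove:
  assumes "finite N" "\<And>u. \<psi> u u = 0" "r \<le> card N"
  shows "(\<Sum>i\<in>N. edge_sum \<psi> (N - {i}) r f) = (real (card N) - real r - 2) * edge_sum \<psi> N r f"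
proof -
  define q where "q Y a b = \<psi> (f (insert a Y)) (f (insert b Y))" for Y a b
  have "(\<Sum>i\<in>N. edge_sum \<psi> (N - {i}) r f)
      = (\<Sum>Y\<in>ksub N r. \<Sum>i\<in>N - Y. \<Sum>a\<in>N - {i} - Y. \<Sum>b\<in>N - {i} - Y. q Y a b)"
    unfolding edge_sum_def q_def by (rule sum_ksub_remove[OF assms(1)])
  also have "\<dots> = (\<Sum>Y\<in>ksub N r. \<Sum>i\<in>N - Y. \<Sum>a\<in>N - Y - {i}. \<Sum>b\<in>N - Y - {i}. q Y a b)"
    by (intro sum.cong refl) auto
  also have "\<dots> = (\<Sum>Y\<in>ksub N r. (real (card N) - real r - 2) * (\<Sum>a\<in>N - Y. \<Sum>b\<in>N - Y. q Y a b))"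
  proof (rule sum.cong[OF refl])
    fix Y assume Y: "Y \<in> ksub N r"
    then have "card (N - Y) = card N - r"
      using assms(1) by (metis (mono_tags, lifting) card_Diff_subset finite_subset ksub_def mem_Collect_eq)
    then show "(\<Sum>i\<in>N - Y. \<Sum>a\<in>N - Y - {i}. \<Sum>b\<in>N - Y - {i}. q Y a b)
      = (real (card N) - real r - 2) * (\<Sum>a\<in>N - Y. \<Sum>b\<in>N - Y. q Y a b)"
      using assms by (subst sum_pairs_remove) (auto simp: q_def of_nat_diff)
  qed
  also have "\<dots> = (real (card N) - real r - 2) * edge_sum \<psi> N r f"
    by (simp add: edge_sum_def q_def sum_distrib_left)
  finally show ?thesis .
qed

text \<open>Splitting at i makes the ordered edge (a, b) over Y a crossing edge with first endpoint
  on the side of i exactly when i = a. Hence the crossing terms of the chain rules, summed over i,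
  recover every ordered edge once.\<close>

lemma sum_edges_at:
  assumes "finite N" "\<And>u. \<psi> u u = 0"
  shows "(\<Sum>i\<in>N. \<Sum>Y\<in>ksub (N - {i}) r. \<Sum>j\<in>N - {i} - Y. \<psi> (f (insert i Y)) (f (insert j Y)))
    = edge_sum \<psi> N r f"
proof -
  have "(\<Sum>i\<in>N. \<Sum>Y\<in>ksub (N - {i}) r. \<Sum>j\<in>N - {i} - Y. \<psi> (f (insert i Y)) (f (insert j Y)))
    = (\<Sum>Y\<in>ksub N r. \<Sum>i\<in>N - Y. \<Sum>j\<in>N - {i} - Y. \<psi> (f (insert i Y)) (f (insert j Y)))"
    by (rule sum_ksub_remove[OF assms(1)])
  also have "\<dots> = edge_sum \<psi> N r f"
    unfolding edge_sum_def
    by (intro sum.cong refl sum.mono_neutral_left) (use assms in auto)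
  finally show ?thesis .
qed

text \<open>
  Condition on whether \<open>i \<in> X\<close> and average over \<open>i\<close>: with \<open>k = Suc r\<close>, an edge of the slice survives
  inside the slice conditioned on \<open>i \<in> X\<close> for \<open>k - 1\<close> choices of \<open>i\<close>, and inside the one conditioned
  on \<open>i \<notin> X\<close> for \<open>n - k - 1\<close> choices. This is the source of the recursion for the constants \<open>A\<close>.
\<close>

lemma edge_induction:
  fixes \<Phi> :: "'a set \<Rightarrow> nat \<Rightarrow> ('a set \<Rightarrow> real) \<Rightarrow> real"
  assumes psi0: "\<And>u. \<psi> u u = 0" and psi_nonneg: "\<And>u v. 0 \<le> \<psi> u v"
    and A_nonneg: "\<And>n k. 0 \<le> A n k"
    and triv: "\<And>N k f. finite N \<Longrightarrow> k = 0 \<or> card N \<le> k \<Longrightarrow> \<Phi> N k f \<le> 0"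
    and chain: "\<And>N r i f. finite N \<Longrightarrow> i \<in> N \<Longrightarrow> Suc r < card N \<Longrightarrow>
      \<Phi> N (Suc r) f \<le> \<Phi> (N - {i}) r (\<lambda>Y. f (insert i Y)) + \<Phi> (N - {i}) (Suc r) f
        + c (card N) (Suc r) / real (card N) *
          (\<Sum>Y\<in>ksub (N - {i}) r. \<Sum>j\<in>N - {i} - Y. \<psi> (f (insert i Y)) (f (insert j Y)))"
    and rec: "\<And>n r. Suc r < n \<Longrightarrow>
      real r * A (n - 1) r + (real n - real r - 2) * A (n - 1) (Suc r) + c n (Suc r) * (real n - 1) / real n
      \<le> (real n - 1) * A n (Suc r)"
    and "finite N"
  shows "\<Phi> N (Suc r) f \<le> A (card N) (Suc r) / real (card N) * edge_sum \<psi> N r f"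
  using \<open>finite N\<close>
proof (induction "card N" arbitrary: N r f rule: less_induct)
  case less
  let ?n = "card N"
  note fin = \<open>finite N\<close>
  have E0: "0 \<le> edge_sum \<psi> M s h" for M s h
    by (rule edge_sum_nonneg) (rule psi_nonneg)
  show ?case
  proof (cases "Suc r < ?n")
    case False
    then have "\<Phi> N (Suc r) f \<le> 0" using triv[OF fin] by auto
    also have "0 \<le> A ?n (Suc r) / real ?n * edge_sum \<psi> N r f"
      by (intro mult_nonneg_nonneg divide_nonneg_nonneg A_nonneg E0) simp
    finally show ?thesis .
  next
    case True
    have n2: "?n \<ge> 2" using True by simp
    define E where "E = edge_sum \<psi> N r f"
    have card': "card (N - {i}) = ?n - 1" if "i \<in> N" for i
      using that fin by simp
    have T1: "(\<Sum>i\<in>N. \<Phi> (N - {i}) r (\<lambda>Y. f (insert i Y))) \<le> A (?n - 1) r / (real ?n - 1) * (real r * E)"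
    \<comment> \<open>For r = 0 the sets containing i form a one-point slice, which the induction
      hypothesis for sizes \<open>Suc s\<close> does not reach; there \<Phi> is at most 0 and the
      factor r makes the bound 0.\<close>
    proof (cases r)
      case 0
      have "(\<Sum>i\<in>N. \<Phi> (N - {i}) r (\<lambda>Y. f (insert i Y))) \<le> 0"
        using triv fin 0 by (intro sum_nonpos) auto
      then show ?thesis using 0 by simp
    next
      case (Suc s)
      have "(\<Sum>i\<in>N. \<Phi> (N - {i}) r (\<lambda>Y. f (insert i Y)))
        \<le> (\<Sum>i\<in>N. A (?n - 1) r / (real ?n - 1) * edge_sum \<psi> (N - {i}) s (\<lambda>Y. f (insert i Y)))"
      proof (rule sum_mono)
        fix i assume i: "i \<in> N"
        have lt: "card (N - {i}) < card N" using card'[OF i] n2 by simp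
        show "\<Phi> (N - {i}) r (\<lambda>Y. f (insert i Y))
          \<le> A (?n - 1) r / (real ?n - 1) * edge_sum \<psi> (N - {i}) s (\<lambda>Y. f (insert i Y))"
          using less(1)[OF lt, of s "\<lambda>Y. f (insert i Y)"] fin n2 card'[OF i]
          by (simp add: Suc of_nat_diff)
      qed
      also have "\<dots> = A (?n - 1) r / (real ?n - 1) * (real r * E)"
        using sum_edge_sum_insert[OF fin, of \<psi> s f] by (subst sum_distrib_left[symmetric]) (simp add: Suc E_def)
      finally show ?thesis .
    qed
    have T2: "(\<Sum>i\<in>N. \<Phi> (N - {i}) (Suc r) f)
      \<le> A (?n - 1) (Suc r) / (real ?n - 1) * ((real ?n - real r - 2) * E)"
    proof -
      have "(\<Sum>i\<in>N. \<Phi> (N - {i}) (Suc r) f)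
        \<le> (\<Sum>i\<in>N. A (?n - 1) (Suc r) / (real ?n - 1) * edge_sum \<psi> (N - {i}) r f)"
      proof (rule sum_mono)
        fix i assume i: "i \<in> N"
        have lt: "card (N - {i}) < card N" using card'[OF i] n2 by simp
        show "\<Phi> (N - {i}) (Suc r) f \<le> A (?n - 1) (Suc r) / (real ?n - 1) * edge_sum \<psi> (N - {i}) r f"
          using less(1)[OF lt, of r f] fin n2 card'[OF i] by (simp add: of_nat_diff)
      qed
      also have "\<dots> = A (?n - 1) (Suc r) / (real ?n - 1) * ((real ?n - real r - 2) * E)"
        using sum_edge_sum_remove[of N \<psi> r f] fin psi0 True by (subst sum_distrib_left[symmetric]) (simp add: E_def)
      finally show ?thesis .
    qed
    have "real ?n * \<Phi> N (Suc r) f = (\<Sum>i\<in>N. \<Phi> N (Suc r) f)" by simp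
    also have "\<dots> \<le> (\<Sum>i\<in>N. \<Phi> (N - {i}) r (\<lambda>Y. f (insert i Y)) + \<Phi> (N - {i}) (Suc r) f
        + c ?n (Suc r) / real ?n *
          (\<Sum>Y\<in>ksub (N - {i}) r. \<Sum>j\<in>N - {i} - Y. \<psi> (f (insert i Y)) (f (insert j Y))))"
      by (intro sum_mono chain fin True)
    also have "\<dots> = (\<Sum>i\<in>N. \<Phi> (N - {i}) r (\<lambda>Y. f (insert i Y))) + (\<Sum>i\<in>N. \<Phi> (N - {i}) (Suc r) f)
        + c ?n (Suc r) / real ?n * E"
      unfolding E_def sum_edges_at[where \<psi> = \<psi> and r = r and f = f, OF fin psi0, symmetric]
      by (simp add: sum.distrib sum_distrib_left)
    also have "\<dots> \<le> A (?n - 1) r / (real ?n - 1) * (real r * E)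
        + A (?n - 1) (Suc r) / (real ?n - 1) * ((real ?n - real r - 2) * E) + c ?n (Suc r) / real ?n * E"
      using T1 T2 by simp
    also have "\<dots> = (real r * A (?n - 1) r + (real ?n - real r - 2) * A (?n - 1) (Suc r)
        + c ?n (Suc r) * (real ?n - 1) / real ?n) / (real ?n - 1) * E"
    proof -
      have "a / p * (s * E) + b / p * (t * E) + d / m * E = (s * a + t * b + d * p / m) / p * E"
        if "p \<noteq> 0" for a b d m p s t :: real
        using that by (simp add: add_divide_distrib distrib_left mult_ac)
      then show ?thesis using n2 by simp
    qed
    also have "\<dots> \<le> ((real ?n - 1) * A ?n (Suc r)) / (real ?n - 1) * E"
      using rec[OF True] n2 E0 unfolding E_def by (intro mult_right_mono divide_right_mono) auto
    also have "\<dots> = A ?n (Suc r) * E" using n2 by simp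
    finally show ?thesis using n2 by (simp add: E_def field_simps)
  qed
qed

section \<open>Splitting a slice at one element: chain rules\<close>

lemma inj_on_insert_ksub:
  "finite N \<Longrightarrow> i \<in> N \<Longrightarrow> inj_on (insert i) (ksub (N - {i}) r)"
  unfolding ksub_def inj_on_def by (metis (no_types, lifting) Diff_insert_absorb mem_Collect_eq subset_Diff_insert)

lemma ksub_split:
  assumes "finite N" "i \<in> N"
  shows "ksub N (Suc r) = insert i ` ksub (N - {i}) r \<union> ksub (N - {i}) (Suc r)"
proof (intro equalityI subsetI)
  fix X assume X: "X \<in> ksub N (Suc r)"
  have fX: "finite X" using X assms finite_of_ksub by metis
  show "X \<in> insert i ` ksub (N - {i}) r \<union> ksub (N - {i}) (Suc r)"
  proof (cases "i \<in> X")
    case True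
    then have "X = insert i (X - {i})" "X - {i} \<in> ksub (N - {i}) r"
      using X fX by (auto simp: ksub_def)
    then show ?thesis by blast
  next
    case False
    then show ?thesis using X by (auto simp: ksub_def)
  qed
next
  fix X assume X: "X \<in> insert i ` ksub (N - {i}) r \<union> ksub (N - {i}) (Suc r)"
  show "X \<in> ksub N (Suc r)"
  proof (cases "X \<in> ksub (N - {i}) (Suc r)")
    case False
    then obtain Y where Y: "X = insert i Y" "Y \<subseteq> N - {i}" "card Y = r"
      using X by (auto simp: ksub_def)
    then have "finite Y" using assms by (meson finite_Diff finite_subset)
    moreover have "i \<notin> Y" using Y by auto
    ultimately show ?thesis using Y assms by (auto simp: ksub_def)
  qed (use assms in \<open>auto simp: ksub_def\<close>)
qed

lemma sum_ksub_split:
  assumes "finite N" "i \<in> N"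
  shows "(\<Sum>X\<in>ksub N (Suc r). g X) = (\<Sum>Y\<in>ksub (N - {i}) r. g (insert i Y)) + (\<Sum>Y\<in>ksub (N - {i}) (Suc r). g Y)"
proof -
  have "insert i ` ksub (N - {i}) r \<inter> ksub (N - {i}) (Suc r) = {}"
    by (auto simp: ksub_def)
  then show ?thesis
    unfolding ksub_split[OF assms] using assms
    by (subst sum.union_disjoint) (auto simp: sum.reindex inj_on_insert_ksub)
qed

lemma ksub_trivial:
  assumes "finite N" "k = 0 \<or> card N \<le> k"
  shows "ksub N k = {} \<or> (\<exists>X. ksub N k = {X})"
proof -
  have "X = (if k = 0 then {} else N)" if "X \<in> ksub N k" for X
  proof -
    have X: "X \<subseteq> N" "card X = k" "finite X"
      using that assms(1) by (auto simp: ksub_def dest: finite_subset)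
    show ?thesis
      using X assms card_seteq[OF assms(1) X(1)] by auto
  qed
  then show ?thesis by blast
qed

definition kmean :: "'a set \<Rightarrow> nat \<Rightarrow> ('a set \<Rightarrow> real) \<Rightarrow> real" where
  "kmean N k f = (\<Sum>X\<in>ksub N k. f X) / real (card (ksub N k))"

text \<open>This and the next two functionals are sums, not averages, so that the contributions of
  the two halves of a split slice simply add, without weights.\<close>

definition L1_dev :: "'a set \<Rightarrow> nat \<Rightarrow> ('a set \<Rightarrow> real) \<Rightarrow> real" where
  "L1_dev N k f = (\<Sum>X\<in>ksub N k. \<bar>f X - kmean N k f\<bar>)"

definition sq_dev :: "'a set \<Rightarrow> nat \<Rightarrow> ('a set \<Rightarrow> real) \<Rightarrow> real" where
  "sq_dev N k f = (\<Sum>X\<in>ksub N k. (f X - kmean N k f)\<^sup>2)"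

definition ent_sq :: "'a set \<Rightarrow> nat \<Rightarrow> ('a set \<Rightarrow> real) \<Rightarrow> real" where
  "ent_sq N k f = (\<Sum>X\<in>ksub N k. (f X)\<^sup>2 * ln ((f X)\<^sup>2))
     - (\<Sum>X\<in>ksub N k. (f X)\<^sup>2) * ln (kmean N k (\<lambda>X. (f X)\<^sup>2))"

lemma dev_trivial:
  assumes "finite N" "k = 0 \<or> card N \<le> k"
  shows "L1_dev N k f \<le> 0" "sq_dev N k f \<le> 0" "ent_sq N k f \<le> 0"
  using ksub_trivial[OF assms] by (auto simp: L1_dev_def sq_dev_def ent_sq_def kmean_def)

lemma sum_kmean: "finite N \<Longrightarrow> k \<le> card N \<Longrightarrow> (\<Sum>X\<in>ksub N k. f X) = real (card (ksub N k)) * kmean N k f"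
  unfolding kmean_def by (simp add: card_ksub)

text \<open>The pairs (Y, j) are the edges between sets containing i and sets avoiding i. Each
  \<open>insert i Y\<close> has \<open>card N - r - 1\<close> of them and each set avoiding i has
  \<open>Suc r\<close>, so a uniformly random crossing edge has uniform endpoints in both halves.
  This coupling is what compares the two halves.\<close>

locale split_at =
  fixes N :: "'a set" and r :: nat and i :: 'a
  assumes fin: "finite N" and iN: "i \<in> N" and lt: "Suc r < card N"
begin

definition "C1 = real (card (ksub (N - {i}) r))"
definition "C0 = real (card (ksub (N - {i}) (Suc r)))"
definition "Npairs = C1 * (real (card N) - real r - 1)"
abbreviation "mean1 f \<equiv> kmean (N - {i}) r (\<lambda>Y. f (insert i Y))"
abbreviation "mean0 f \<equiv> kmean (N - {i}) (Suc r) f"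
abbreviation "pair_sum g \<equiv> (\<Sum>Y\<in>ksub (N - {i}) r. \<Sum>j\<in>N - {i} - Y. g Y j)"

lemma C_pos: "C1 > 0" "C0 > 0"
  using fin iN lt by (auto simp: C1_def C0_def card_ksub)

lemma card_eq: "real (card (ksub N (Suc r))) = C1 + C0"
  using sum_ksub_split[OF fin iN, of "\<lambda>_. 1::real" r] by (simp add: C1_def C0_def)

lemma sum1: "(\<Sum>Y\<in>ksub (N - {i}) r. f (insert i Y)) = C1 * mean1 f"
  unfolding C1_def by (rule sum_kmean) (use fin iN lt in auto)

lemma sum0: "(\<Sum>Y\<in>ksub (N - {i}) (Suc r). f Y) = C0 * mean0 f"
  unfolding C0_def by (rule sum_kmean) (use fin iN lt in auto)

lemma mean_eq: "(C1 + C0) * kmean N (Suc r) f = C1 * mean1 f + C0 * mean0 f"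
proof -
  have "(C1 + C0) * kmean N (Suc r) f = (\<Sum>X\<in>ksub N (Suc r). f X)"
    unfolding kmean_def card_eq[symmetric] using C_pos card_eq by simp
  then show ?thesis
    using sum_ksub_split[OF fin iN, of f r] sum1[of f] sum0[of f] by simp
qed

lemma card_diff: "Y \<in> ksub (N - {i}) r \<Longrightarrow> real (card (N - {i} - Y)) = real (card N) - real r - 1"
  using fin iN lt by (auto simp: ksub_def card_Diff_subset finite_subset of_nat_diff)

lemma pair_sum1: "pair_sum (\<lambda>Y j. g (insert i Y)) = Npairs * mean1 g"
proof -
  have "pair_sum (\<lambda>Y j. g (insert i Y)) = (\<Sum>Y\<in>ksub (N - {i}) r. (real (card N) - real r - 1) * g (insert i Y))"
    by (intro sum.cong refl) (simp add: card_diff)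
  then show ?thesis using sum1[of g] by (simp add: Npairs_def flip: sum_distrib_left)
qed

lemma pair_sum0_aux: "pair_sum (\<lambda>Y j. g (insert j Y)) = real (Suc r) * C0 * mean0 g"
proof -
  have "pair_sum (\<lambda>Y j. g (insert j Y)) = (\<Sum>Z\<in>ksub (N - {i}) (Suc r). \<Sum>j\<in>Z. g Z)"
    using sum_ksub_remove[of "N - {i}" "\<lambda>j Y. g (insert j Y)" r, symmetric]
      sum_ksub_insert[of "N - {i}" "\<lambda>j Y. g Y" r] fin by simp
  also have "\<dots> = (\<Sum>Z\<in>ksub (N - {i}) (Suc r). real (Suc r) * g Z)"
    by (intro sum.cong refl) (auto simp: ksub_def)
  finally show ?thesis using sum0[of g] by (simp flip: sum_distrib_left)
qed

lemma Npairs_eq: "Npairs = real (Suc r) * C0"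
proof -
  have "kmean (N - {i}) (Suc r) (\<lambda>_. 1) = 1" "kmean (N - {i}) r (\<lambda>_. 1) = 1"
    using C_pos by (auto simp: kmean_def C1_def C0_def)
  then show ?thesis
    using pair_sum0_aux[of "\<lambda>_. 1"] pair_sum1[of "\<lambda>_. 1"] by simp
qed

lemma pair_sum0: "pair_sum (\<lambda>Y j. g (insert j Y)) = Npairs * mean0 g"
  using pair_sum0_aux Npairs_eq by simp

lemma Npairs_pos: "Npairs > 0"
  using Npairs_eq C_pos by simp

lemma ratio1: "C1 / (C1 + C0) = real (Suc r) / real (card N)"
proof -
  have "C1 * (real (card N) - real r - 1) = real (Suc r) * C0"
    using Npairs_eq by (simp add: Npairs_def)
  then have "C1 * real (card N) = real (Suc r) * (C1 + C0)" by (simp add: algebra_simps)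
  then show ?thesis using C_pos lt by (simp add: field_simps)
qed

lemma ratio0: "C0 / (C1 + C0) = (real (card N) - real (Suc r)) / real (card N)"
proof -
  have "C0 / (C1 + C0) = 1 - C1 / (C1 + C0)" using C_pos by (simp add: field_simps)
  also have "\<dots> = (real (card N) - real (Suc r)) / real (card N)"
    using lt by (subst ratio1) (simp add: field_simps)
  finally show ?thesis .
qed

text \<open>The left side is the weight of the squared difference of the means in the variance
  between the halves. Written through the number of crossing edges, it turns averages over these
  edges into sums.\<close>

lemma weight: "C1 * C0 / (C1 + C0) = Npairs / real (card N)"
  using ratio1 Npairs_eq by (metis mult.commute times_divide_eq_right times_divide_eq_left)

lemma pair_card: "real (card (Sigma (ksub (N - {i}) r) (\<lambda>Y. N - {i} - Y))) = Npairs"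
proof -
  have "kmean (N - {i}) r (\<lambda>_. 1) = 1" using C_pos by (auto simp: kmean_def C1_def)
  then show ?thesis
    using pair_sum1[of "\<lambda>_. 1"] fin by (simp add: card_SigmaI)
qed

lemma pair_sum_Sigma: "pair_sum g = (\<Sum>p\<in>Sigma (ksub (N - {i}) r) (\<lambda>Y. N - {i} - Y). g (fst p) (snd p))"
  using fin by (subst sum.Sigma) (auto simp: case_prod_beta)

text \<open>Moving from the mean of a half to the overall mean costs
  \<open>C1 * C0 / (C1 + C0)\<close> times the difference of the means in each half, which explains
  the 2. By the coupling, that difference is an average of differences of f along crossing
  edges.\<close>

lemma L1_chain:
  "L1_dev N (Suc r) f \<le> L1_dev (N - {i}) r (\<lambda>Y. f (insert i Y)) + L1_dev (N - {i}) (Suc r) f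
    + 2 / real (card N) * pair_sum (\<lambda>Y j. \<bar>f (insert i Y) - f (insert j Y)\<bar>)"
proof -
  define m where "m = kmean N (Suc r) f"
  have m: "m = (C1 * mean1 f + C0 * mean0 f) / (C1 + C0)"
    using mean_eq[of f] C_pos by (simp add: m_def field_simps)
  have "Npairs * \<bar>mean1 f - mean0 f\<bar> = \<bar>pair_sum (\<lambda>Y j. f (insert i Y) - f (insert j Y))\<bar>"
    using Npairs_pos pair_sum1[of f] pair_sum0[of f]
    by (simp add: sum_subtractf abs_mult flip: right_diff_distrib)
  also have "\<dots> \<le> pair_sum (\<lambda>Y j. \<bar>f (insert i Y) - f (insert j Y)\<bar>)" (is "_ \<le> ?P")
    by (intro order_trans[OF sum_abs] sum_mono sum_abs)
  finally have P: "Npairs * \<bar>mean1 f - mean0 f\<bar> \<le> ?P" .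
  have d1: "mean1 f - m = C0 / (C1 + C0) * (mean1 f - mean0 f)"
    and d0: "mean0 f - m = - (C1 / (C1 + C0) * (mean1 f - mean0 f))"
    unfolding m using C_pos by (simp_all add: field_simps)
  have "L1_dev N (Suc r) f = (\<Sum>Y\<in>ksub (N - {i}) r. \<bar>f (insert i Y) - m\<bar>) + (\<Sum>Y\<in>ksub (N - {i}) (Suc r). \<bar>f Y - m\<bar>)"
    unfolding L1_dev_def m_def by (rule sum_ksub_split[OF fin iN])
  also have "(\<Sum>Y\<in>ksub (N - {i}) r. \<bar>f (insert i Y) - m\<bar>)
      \<le> (\<Sum>Y\<in>ksub (N - {i}) r. \<bar>f (insert i Y) - mean1 f\<bar> + \<bar>mean1 f - m\<bar>)"
    by (intro sum_mono) linarith
  also have "\<dots> = L1_dev (N - {i}) r (\<lambda>Y. f (insert i Y)) + C1 * \<bar>mean1 f - m\<bar>"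
    by (simp add: sum.distrib L1_dev_def C1_def)
  also have "(\<Sum>Y\<in>ksub (N - {i}) (Suc r). \<bar>f Y - m\<bar>)
      \<le> (\<Sum>Y\<in>ksub (N - {i}) (Suc r). \<bar>f Y - mean0 f\<bar> + \<bar>mean0 f - m\<bar>)"
    by (intro sum_mono) linarith
  also have "\<dots> = L1_dev (N - {i}) (Suc r) f + C0 * \<bar>mean0 f - m\<bar>"
    by (simp add: sum.distrib L1_dev_def C0_def)
  also have "C1 * \<bar>mean1 f - m\<bar> = C1 * C0 / (C1 + C0) * \<bar>mean1 f - mean0 f\<bar>"
    unfolding d1 using C_pos by (simp add: abs_mult)
  also have "C0 * \<bar>mean0 f - m\<bar> = C1 * C0 / (C1 + C0) * \<bar>mean1 f - mean0 f\<bar>"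
    unfolding d0 using C_pos by (simp add: abs_mult)
  finally have "L1_dev N (Suc r) f \<le> L1_dev (N - {i}) r (\<lambda>Y. f (insert i Y)) + L1_dev (N - {i}) (Suc r) f
     + 2 / real (card N) * (Npairs * \<bar>mean1 f - mean0 f\<bar>)"
    by (simp add: weight)
  also have "\<dots> \<le> L1_dev (N - {i}) r (\<lambda>Y. f (insert i Y)) + L1_dev (N - {i}) (Suc r) f
     + 2 / real (card N) * ?P"
    using P by (intro add_left_mono mult_left_mono) auto
  finally show ?thesis .
qed

text \<open>Deviations from the mean of a half sum to zero, so the cross terms vanish and exactly
  the two-point variance of the means is left over. Cauchy-Schwarz over the crossing edges bounds
  it.\<close>

lemma sq_chain:
  "sq_dev N (Suc r) f \<le> sq_dev (N - {i}) r (\<lambda>Y. f (insert i Y)) + sq_dev (N - {i}) (Suc r) f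
    + 1 / real (card N) * pair_sum (\<lambda>Y j. (f (insert i Y) - f (insert j Y))\<^sup>2)"
proof -
  define m where "m = kmean N (Suc r) f"
  have m: "m = (C1 * mean1 f + C0 * mean0 f) / (C1 + C0)"
    using mean_eq[of f] C_pos by (simp add: m_def field_simps)
  let ?D = "Sigma (ksub (N - {i}) r) (\<lambda>Y. N - {i} - Y)"
  let ?P = "pair_sum (\<lambda>Y j. (f (insert i Y) - f (insert j Y))\<^sup>2)"
  have "(Npairs * (mean1 f - mean0 f))\<^sup>2 = (pair_sum (\<lambda>Y j. f (insert i Y) - f (insert j Y)))\<^sup>2"
    using pair_sum1[of f] pair_sum0[of f] by (simp add: sum_subtractf right_diff_distrib)
  also have "\<dots> \<le> Npairs * ?P"
    using Cauchy_Schwarz_ineq_sum[of "\<lambda>_. 1" "\<lambda>p. f (insert i (fst p)) - f (insert (snd p) (fst p))" ?D]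
    by (simp add: pair_sum_Sigma pair_card)
  finally have "Npairs * (Npairs * (mean1 f - mean0 f)\<^sup>2) \<le> Npairs * ?P"
    by (simp add: power2_eq_square mult_ac)
  then have P: "Npairs * (mean1 f - mean0 f)\<^sup>2 \<le> ?P"
    using Npairs_pos by simp
  have d1: "mean1 f - m = C0 / (C1 + C0) * (mean1 f - mean0 f)"
    and d0: "mean0 f - m = - (C1 / (C1 + C0) * (mean1 f - mean0 f))"
    unfolding m using C_pos by (simp_all add: field_simps)
  have dev: "(\<Sum>Y\<in>F. (h Y - m)\<^sup>2) = (\<Sum>Y\<in>F. (h Y - a)\<^sup>2) + real (card F) * (a - m)\<^sup>2"
    if "(\<Sum>Y\<in>F. h Y) = real (card F) * a" for F :: "'a set set" and h a
  proof -
    have "(\<Sum>Y\<in>F. (h Y - m)\<^sup>2) = (\<Sum>Y\<in>F. (h Y - a)\<^sup>2 + 2 * (a - m) * (h Y - a) + (a - m)\<^sup>2)"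
      by (intro sum.cong refl) (simp add: power2_eq_square algebra_simps)
    also have "\<dots> = (\<Sum>Y\<in>F. (h Y - a)\<^sup>2) + 2 * (a - m) * ((\<Sum>Y\<in>F. h Y) - real (card F) * a) + real (card F) * (a - m)\<^sup>2"
      by (simp add: sum.distrib sum_subtractf flip: sum_distrib_left)
    finally show ?thesis using that by simp
  qed
  have "sq_dev N (Suc r) f = (\<Sum>Y\<in>ksub (N - {i}) r. (f (insert i Y) - m)\<^sup>2) + (\<Sum>Y\<in>ksub (N - {i}) (Suc r). (f Y - m)\<^sup>2)"
    unfolding sq_dev_def m_def by (rule sum_ksub_split[OF fin iN])
  also have "\<dots> = sq_dev (N - {i}) r (\<lambda>Y. f (insert i Y)) + sq_dev (N - {i}) (Suc r) f
      + (C1 * (mean1 f - m)\<^sup>2 + C0 * (mean0 f - m)\<^sup>2)"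
    using dev[OF sum1[of f, unfolded C1_def]] dev[OF sum0[of f, unfolded C0_def]]
    by (simp add: sq_dev_def C1_def C0_def)
  also have "C1 * (mean1 f - m)\<^sup>2 + C0 * (mean0 f - m)\<^sup>2
      = (C1 * C0\<^sup>2 + C0 * C1\<^sup>2) / (C1 + C0)\<^sup>2 * (mean1 f - mean0 f)\<^sup>2"
    unfolding d1 d0 by (simp add: power_mult_distrib power_divide add_divide_distrib distrib_right)
  also have "(C1 * C0\<^sup>2 + C0 * C1\<^sup>2) / (C1 + C0)\<^sup>2 = C1 * C0 / (C1 + C0)"
    using C_pos by (simp add: divide_eq_eq eq_divide_eq) (simp add: power2_eq_square algebra_simps)
  finally show ?thesis using P lt by (simp add: weight divide_right_mono)
qed

end

text \<open>The bound \<open>ln x \<le> x - 1\<close> reduces entropy to variance divided by m. Then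
  \<alpha> - \<beta> is factored through square roots, and the sum of the roots is absorbed by m,
  since m is at least each of its two weighted terms. The price is a constant linear in the inverse
  weights of the two points.\<close>

lemma entropy_two_point:
  fixes \<alpha> \<beta> m C1 C0 :: real
  assumes "C1 > 0" "C0 > 0" "\<alpha> \<ge> 0" "\<beta> \<ge> 0" and m: "(C1 + C0) * m = C1 * \<alpha> + C0 * \<beta>"
  shows "C1 * \<alpha> * ln \<alpha> + C0 * \<beta> * ln \<beta> - (C1 * \<alpha> + C0 * \<beta>) * ln m
    \<le> 2 * (C1 * C0 / (C1 + C0)) * ((C1 + C0) / C1 + (C1 + C0) / C0) * (sqrt \<alpha> - sqrt \<beta>)\<^sup>2"
proof (cases "m = 0")
  case True
  then have "C1 * \<alpha> + C0 * \<beta> = 0" using m by simp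
  then have "C1 * \<alpha> = 0" "C0 * \<beta> = 0"
    using assms by (smt (verit) mult_nonneg_nonneg)+
  then have "\<alpha> = 0" "\<beta> = 0" using assms by auto
  then show ?thesis by simp
next
  case False
  have "(C1 + C0) * m \<ge> 0" unfolding m using assms by simp
  then have m0: "m > 0" using assms(1,2) False by (smt (verit) mult_pos_neg)
  have ln_le: "x * ln x \<le> x * ln m + x * (x / m - 1)" if "x \<ge> 0" for x
  proof (cases "x = 0")
    case False
    then have "x > 0" using that by simp
    then have "ln x - ln m \<le> x / m - 1"
      using m0 ln_le_minus_one[of "x / m"] by (simp add: ln_div)
    then have "x * (ln x - ln m) \<le> x * (x / m - 1)"
      using that by (rule mult_left_mono)
    then show ?thesis by (simp add: algebra_simps)
  qed simp
  define D where "D = C1 + C0"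
  have D0: "D > 0" using assms by (simp add: D_def)
  have mD: "m = (C1 * \<alpha> + C0 * \<beta>) / D" using m D0 by (simp add: D_def field_simps)
  have "C1 * \<alpha> * ln \<alpha> + C0 * \<beta> * ln \<beta> - (C1 * \<alpha> + C0 * \<beta>) * ln m
      \<le> C1 * (\<alpha> * (\<alpha> / m - 1)) + C0 * (\<beta> * (\<beta> / m - 1))"
    using mult_left_mono[OF ln_le[of \<alpha>], of C1] mult_left_mono[OF ln_le[of \<beta>], of C0] assms
    by (simp add: algebra_simps)
  also have "\<dots> = (C1 * \<alpha>\<^sup>2 + C0 * \<beta>\<^sup>2 - D * m\<^sup>2) / m"
    using m m0 by (simp add: D_def field_simps power2_eq_square)
  also have "C1 * \<alpha>\<^sup>2 + C0 * \<beta>\<^sup>2 - D * m\<^sup>2 = C1 * C0 / D * (\<alpha> - \<beta>)\<^sup>2"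
  proof -
    have "D * (C1 * \<alpha>\<^sup>2 + C0 * \<beta>\<^sup>2 - D * m\<^sup>2) = D * (C1 * \<alpha>\<^sup>2 + C0 * \<beta>\<^sup>2) - (D * m)\<^sup>2"
      by (simp add: power2_eq_square algebra_simps)
    also have "\<dots> = C1 * C0 * (\<alpha> - \<beta>)\<^sup>2"
      unfolding D_def m by (simp add: power2_eq_square algebra_simps)
    finally show ?thesis using D0 by (simp add: field_simps)
  qed
  also have "C1 * C0 / D * (\<alpha> - \<beta>)\<^sup>2 / m
      \<le> 2 * (C1 * C0 / D) * (D / C1 + D / C0) * (sqrt \<alpha> - sqrt \<beta>)\<^sup>2"
  proof -
    have "(\<alpha> - \<beta>)\<^sup>2 = ((sqrt \<alpha>)\<^sup>2 - (sqrt \<beta>)\<^sup>2)\<^sup>2" using assms by simp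
    also have "\<dots> = (sqrt \<alpha> - sqrt \<beta>)\<^sup>2 * (sqrt \<alpha> + sqrt \<beta>)\<^sup>2"
      by (simp add: power2_eq_square algebra_simps)
    also have "(sqrt \<alpha> + sqrt \<beta>)\<^sup>2 \<le> 2 * (\<alpha> + \<beta>)"
      using assms sum_squares_bound[of "sqrt \<alpha>" "sqrt \<beta>"] by (simp add: power2_sum)
    also have "\<alpha> + \<beta> \<le> m * (D / C1 + D / C0)"
    proof -
      have "\<alpha> \<le> m * (D / C1)" "\<beta> \<le> m * (D / C0)"
        unfolding mD using assms D0 by (simp_all add: field_simps)
      then show ?thesis by (simp add: distrib_left)
    qed
    finally have "(\<alpha> - \<beta>)\<^sup>2 \<le> (sqrt \<alpha> - sqrt \<beta>)\<^sup>2 * (2 * (m * (D / C1 + D / C0)))"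
      by (simp add: mult_left_mono)
    then have "(\<alpha> - \<beta>)\<^sup>2 / m \<le> 2 * (D / C1 + D / C0) * (sqrt \<alpha> - sqrt \<beta>)\<^sup>2"
      using m0 by (simp add: divide_le_eq mult_ac)
    then have "C1 * C0 / D * ((\<alpha> - \<beta>)\<^sup>2 / m) \<le> C1 * C0 / D * (2 * (D / C1 + D / C0) * (sqrt \<alpha> - sqrt \<beta>)\<^sup>2)"
      using assms D0 by (intro mult_left_mono) auto
    then show ?thesis by (simp add: mult_ac)
  qed
  finally show ?thesis
    unfolding D_def using m0 by (simp add: divide_right_mono)
qed

context split_at
begin

text \<open>Entropy splits exactly into the entropies of the halves and the two-point entropy of the
  means of the squares. The roots of \<alpha> and \<beta> are the L2 norms of f at the two ends of a
  random crossing edge, so the reverse triangle inequality bounds their difference by the L2 norm of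
  the difference along the edge.\<close>

lemma ent_chain:
  "ent_sq N (Suc r) f \<le> ent_sq (N - {i}) r (\<lambda>Y. f (insert i Y)) + ent_sq (N - {i}) (Suc r) f
    + 2 * (real (card N) / real (Suc r) + real (card N) / (real (card N) - real (Suc r))) / real (card N)
      * pair_sum (\<lambda>Y j. (f (insert i Y) - f (insert j Y))\<^sup>2)"
proof -
  define g where "g = (\<lambda>X. (f X)\<^sup>2)"
  define \<alpha> where "\<alpha> = mean1 g"
  define \<beta> where "\<beta> = mean0 g"
  define m where "m = kmean N (Suc r) g"
  let ?D = "Sigma (ksub (N - {i}) r) (\<lambda>Y. N - {i} - Y)"
  let ?P = "pair_sum (\<lambda>Y j. (f (insert i Y) - f (insert j Y))\<^sup>2)"
  have nonneg: "\<alpha> \<ge> 0" "\<beta> \<ge> 0"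
    by (auto simp: \<alpha>_def \<beta>_def g_def kmean_def intro!: divide_nonneg_nonneg sum_nonneg)
  have P: "Npairs * (sqrt \<alpha> - sqrt \<beta>)\<^sup>2 \<le> ?P"
  proof -
    define u where "u p = f (insert i (fst p))" for p :: "'a set \<times> 'a"
    define v where "v p = f (insert (snd p) (fst p))" for p :: "'a set \<times> 'a"
    have U: "(\<Sum>p\<in>?D. (u p)\<^sup>2) = Npairs * \<alpha>" and V: "(\<Sum>p\<in>?D. (v p)\<^sup>2) = Npairs * \<beta>"
      using pair_sum1[of g, unfolded pair_sum_Sigma] pair_sum0[of g, unfolded pair_sum_Sigma]
      by (simp_all add: u_def v_def g_def \<alpha>_def \<beta>_def)
    have "(\<Sum>p\<in>?D. u p * v p)\<^sup>2 \<le> (Npairs * \<alpha>) * (Npairs * \<beta>)"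
      using Cauchy_Schwarz_ineq_sum[of u v ?D] by (simp add: U V)
    also have "\<dots> = (Npairs * (sqrt \<alpha> * sqrt \<beta>))\<^sup>2"
      using nonneg by (simp add: power_mult_distrib) (simp add: power2_eq_square)
    finally have "(\<Sum>p\<in>?D. u p * v p) \<le> Npairs * (sqrt \<alpha> * sqrt \<beta>)"
      by (rule power2_le_imp_le) (use Npairs_pos nonneg in auto)
    moreover have "?P = Npairs * \<alpha> + Npairs * \<beta> - 2 * (\<Sum>p\<in>?D. u p * v p)"
      unfolding pair_sum_Sigma U[symmetric] V[symmetric]
      by (simp add: u_def v_def power2_diff sum.distrib sum_subtractf sum_distrib_left mult_ac)
    moreover have "Npairs * (sqrt \<alpha> - sqrt \<beta>)\<^sup>2 = Npairs * \<alpha> + Npairs * \<beta> - 2 * (Npairs * (sqrt \<alpha> * sqrt \<beta>))"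
      using nonneg by (simp add: power2_diff algebra_simps)
    ultimately show ?thesis by linarith
  qed
  have ratios: "(C1 + C0) / C1 = real (card N) / real (Suc r)"
    "(C1 + C0) / C0 = real (card N) / (real (card N) - real (Suc r))"
    using arg_cong[OF ratio1, of inverse] arg_cong[OF ratio0, of inverse] by simp_all
  define c where "c = 2 * (real (card N) / real (Suc r) + real (card N) / (real (card N) - real (Suc r)))"
  have c0: "c \<ge> 0" using lt by (simp add: c_def)
  have "ent_sq N (Suc r) f = (\<Sum>X\<in>ksub N (Suc r). g X * ln (g X)) - (\<Sum>X\<in>ksub N (Suc r). g X) * ln m"
    by (simp add: ent_sq_def g_def m_def)
  also have "\<dots> = (\<Sum>Y\<in>ksub (N - {i}) r. g (insert i Y) * ln (g (insert i Y)))
      + (\<Sum>Y\<in>ksub (N - {i}) (Suc r). g Y * ln (g Y)) - (C1 * \<alpha> + C0 * \<beta>) * ln m"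
    using sum_ksub_split[OF fin iN, of "\<lambda>X. g X * ln (g X)" r] sum_ksub_split[OF fin iN, of g r]
      sum1[of g] sum0[of g] by (simp add: \<alpha>_def \<beta>_def)
  also have "\<dots> = ent_sq (N - {i}) r (\<lambda>Y. f (insert i Y)) + ent_sq (N - {i}) (Suc r) f
      + (C1 * \<alpha> * ln \<alpha> + C0 * \<beta> * ln \<beta> - (C1 * \<alpha> + C0 * \<beta>) * ln m)"
    using sum1[of g] sum0[of g] by (simp add: ent_sq_def g_def \<alpha>_def \<beta>_def)
  also have "\<dots> \<le> ent_sq (N - {i}) r (\<lambda>Y. f (insert i Y)) + ent_sq (N - {i}) (Suc r) f
      + 2 * (C1 * C0 / (C1 + C0)) * ((C1 + C0) / C1 + (C1 + C0) / C0) * (sqrt \<alpha> - sqrt \<beta>)\<^sup>2"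
    using mean_eq[of g] C_pos nonneg
    by (intro add_left_mono entropy_two_point) (auto simp: \<alpha>_def \<beta>_def m_def)
  also have "2 * (C1 * C0 / (C1 + C0)) * ((C1 + C0) / C1 + (C1 + C0) / C0) * (sqrt \<alpha> - sqrt \<beta>)\<^sup>2
      = c / real (card N) * (Npairs * (sqrt \<alpha> - sqrt \<beta>)\<^sup>2)"
    unfolding ratios weight c_def by simp
  also have "\<dots> \<le> c / real (card N) * ?P"
    using P c0 by (intro mult_left_mono) auto
  finally show ?thesis by (simp add: c_def)
qed

end

text \<open>With A = c constant the recursion reads (n - 2) + (n - 1)/n \<le> n - 1, so the constant
  of the chain rule survives the induction unchanged; the same holds in \<open>poincare\<close>. The
  L1 version serves to bound the distance of f from its mean by the total influence.\<close>

theorem L1_poincare: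
  assumes "finite N"
  shows "L1_dev N (Suc r) f \<le> 2 / real (card N) * edge_sum (\<lambda>u v. \<bar>u - v\<bar>) N r f"
proof (rule edge_induction[where A = "\<lambda>_ _. 2" and c = "\<lambda>_ _. 2" and \<Phi> = L1_dev])
  fix N :: "'a set" and r i f assume "finite N" "i \<in> N" "Suc r < card N"
  then interpret split_at N r i by unfold_locales
  show "L1_dev N (Suc r) f \<le> L1_dev (N - {i}) r (\<lambda>Y. f (insert i Y)) + L1_dev (N - {i}) (Suc r) f
    + 2 / real (card N) * pair_sum (\<lambda>Y j. \<bar>f (insert i Y) - f (insert j Y)\<bar>)"
    by (rule L1_chain)
qed (use assms in \<open>auto intro: dev_trivial simp: field_simps\<close>)

theorem poincare:
  assumes "finite N"
  shows "sq_dev N (Suc r) f \<le> 1 / real (card N) * edge_sum (\<lambda>u v. (u - v)\<^sup>2) N r f"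
proof (rule edge_induction[where A = "\<lambda>_ _. 1" and c = "\<lambda>_ _. 1" and \<Phi> = sq_dev])
  fix N :: "'a set" and r i f assume "finite N" "i \<in> N" "Suc r < card N"
  then interpret split_at N r i by unfold_locales
  show "sq_dev N (Suc r) f \<le> sq_dev (N - {i}) r (\<lambda>Y. f (insert i Y)) + sq_dev (N - {i}) (Suc r) f
    + 1 / real (card N) * pair_sum (\<lambda>Y j. (f (insert i Y) - f (insert j Y))\<^sup>2)"
    by (rule sq_chain)
qed (use assms in \<open>auto intro: dev_trivial simp: field_simps\<close>)

text \<open>
  With \<open>A n k = 2 * (n / k + n / (n - k))\<close>, which also serves as the two-point constant \<open>c\<close>, the
  recursion of \<open>edge_induction\<close> holds with equality, except for vanishing terms at \<open>k = 1\<close> and \<open>k = n - 1\<close>.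
\<close>

theorem log_sobolev:
  assumes "finite N" "Suc r < card N"
  shows "ent_sq N (Suc r) f \<le>
    2 * (real (card N) / real (Suc r) + real (card N) / (real (card N) - real (Suc r))) / real (card N)
      * edge_sum (\<lambda>u v. (u - v)\<^sup>2) N r f"
proof -
  \<comment> \<open>The value 0 for k \<ge> n keeps A nonnegative everywhere; the formula itself is
    negative for k > n > 0.\<close>
  define A :: "nat \<Rightarrow> nat \<Rightarrow> real" where
    "A n k = (if k < n then 2 * (real n / real k + real n / (real n - real k)) else 0)" for n k
  have "ent_sq N (Suc r) f \<le> A (card N) (Suc r) / real (card N) * edge_sum (\<lambda>u v. (u - v)\<^sup>2) N r f"
  proof (rule edge_induction[where A = A and c = A and \<Phi> = ent_sq])
    fix N :: "'a set" and r i f assume "finite N" "i \<in> N" and lt: "Suc r < card N"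
    then interpret split_at N r i by unfold_locales
    show "ent_sq N (Suc r) f \<le> ent_sq (N - {i}) r (\<lambda>Y. f (insert i Y)) + ent_sq (N - {i}) (Suc r) f
      + A (card N) (Suc r) / real (card N) * pair_sum (\<lambda>Y j. (f (insert i Y) - f (insert j Y))\<^sup>2)"
      using ent_chain[of f] lt by (simp add: A_def)
  next
    fix n r :: nat assume lt: "Suc r < n"
    \<comment> \<open>With k = \<open>Suc r\<close> these are a = k - 1 and b = n - k - 1.
      Exchanging them corresponds to complementing sets, and it exchanges the bounds 1 and 2
      below.\<close>
    define a where "a = real r"
    define b where "b = real n - real r - 2"
    have ab: "a \<ge> 0" "b \<ge> 0" using lt by (auto simp: a_def b_def)
    have n: "real n = a + b + 2" by (simp add: a_def b_def)
    then have b_eq: "real n - a - 2 = b" by simp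
    from n have diff_simps: "real n - 1 = a + b + 1" by simp
    have cancel: "x * (2 * (s / x + s / t)) = 2 * s * (1 + x / t)" if "x \<noteq> 0" for x s t :: real
      using that by (simp add: distrib_left mult_ac)
    have 1: "a * A (n - 1) r \<le> 2 * (a + b + 1) * (1 + a / (b + 1))"
    proof (cases "r = 0")
      case False
      then have "a > 0" by (simp add: a_def)
      have "A (n - 1) r = 2 * ((a + b + 1) / a + (a + b + 1) / (b + 1))"
        using lt False by (simp add: A_def a_def b_def of_nat_diff algebra_simps)
      then show ?thesis using cancel[of a "a + b + 1" "b + 1"] \<open>a > 0\<close> by simp
    qed (use ab in \<open>simp add: a_def\<close>)
    have 2: "b * A (n - 1) (Suc r) \<le> 2 * (a + b + 1) * (1 + b / (a + 1))"
    proof (cases "b = 0")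
      case False
      then have "b > 0" using ab by simp
      then have "Suc r < n - 1" using lt by (auto simp: b_def)
      then have "A (n - 1) (Suc r) = 2 * ((a + b + 1) / (a + 1) + (a + b + 1) / b)"
        using lt False by (simp add: A_def a_def b_def of_nat_diff algebra_simps)
      then show ?thesis using cancel[of b "a + b + 1" "a + 1"] \<open>b > 0\<close> by (simp add: add.commute)
    qed (use ab in simp)
    have 3: "A n (Suc r) = 2 * ((a + b + 2) / (a + 1) + (a + b + 2) / (b + 1))"
      using lt by (simp add: A_def a_def b_def algebra_simps)
    have "a * A (n - 1) r + b * A (n - 1) (Suc r) + A n (Suc r) * (a + b + 1) / (a + b + 2)
      \<le> 2 * (a + b + 1) * (1 + a / (b + 1)) + 2 * (a + b + 1) * (1 + b / (a + 1))
        + 2 * (a + b + 1) * (1 / (a + 1) + 1 / (b + 1))"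
    proof -
      have "A n (Suc r) * (a + b + 1) / (a + b + 2) = 2 * (a + b + 1) * (1 / (a + 1) + 1 / (b + 1))"
      proof -
        have "A n (Suc r) = (a + b + 2) * (2 * (1 / (a + 1) + 1 / (b + 1)))"
          unfolding 3 by (simp add: algebra_simps)
        moreover have "s * (2 * q) * t / s = 2 * t * q" if "s \<noteq> 0" for s q t :: real
          using that by simp
        ultimately show ?thesis using ab by (metis add_nonneg_pos less_irrefl zero_less_numeral add_nonneg_nonneg)
      qed
      then show ?thesis using 1 2 by simp
    qed
    also have "\<dots> = 2 * (a + b + 1) * ((1 + a / (b + 1) + 1 / (b + 1)) + (1 + b / (a + 1) + 1 / (a + 1)))"
      by (simp add: algebra_simps)
    also have "1 + a / (b + 1) + 1 / (b + 1) = (a + b + 2) / (b + 1)"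
      using ab by (simp add: field_simps)
    also have "1 + b / (a + 1) + 1 / (a + 1) = (a + b + 2) / (a + 1)"
      using ab by (simp add: field_simps)
    also have "2 * (a + b + 1) * ((a + b + 2) / (b + 1) + (a + b + 2) / (a + 1)) = (a + b + 1) * A n (Suc r)"
      unfolding 3 by (simp only: mult_ac add_ac)
    finally show "real r * A (n - 1) r + (real n - real r - 2) * A (n - 1) (Suc r)
        + A n (Suc r) * (real n - 1) / real n \<le> (real n - 1) * A n (Suc r)"
      by (simp only: n[symmetric] a_def [symmetric] diff_simps b_eq)
  qed (use assms in \<open>auto intro: dev_trivial simp: A_def\<close>)
  then show ?thesis using assms by (simp add: A_def)
qed

section \<open>Smoothing by random transpositions\<close>

definition sw :: "'a \<Rightarrow> 'a \<Rightarrow> 'a set \<Rightarrow> 'a set" where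
  "sw i j X = Transposition.transpose i j ` X"

lemma sw_sw [simp]: "sw i j (sw i j X) = X"
  by (simp add: sw_def image_image)

lemma sw_same [simp]: "sw i i X = X"
  by (simp add: sw_def)

lemma sw_commute: "sw i j = sw j i"
  by (simp add: sw_def fun_eq_iff transpose_commute)

lemma mem_sw: "x \<in> sw i j X \<longleftrightarrow> Transposition.transpose i j x \<in> X"
  unfolding sw_def by (metis image_iff transpose_involutory)

lemma sw_id: "(i \<in> X \<longleftrightarrow> j \<in> X) \<Longrightarrow> sw i j X = X"
  unfolding set_eq_iff mem_sw by (simp add: Transposition.transpose_def)

lemma sw_exchange: "a \<in> X \<Longrightarrow> b \<notin> X \<Longrightarrow> sw a b X = insert b (X - {a})"
  unfolding set_eq_iff mem_sw by (auto simp: Transposition.transpose_def)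

lemma sw_ksub: "i \<in> N \<Longrightarrow> j \<in> N \<Longrightarrow> X \<in> ksub N k \<Longrightarrow> sw i j X \<in> ksub N k"
  unfolding ksub_def
  by (auto simp: mem_sw card_image sw_def) (metis subsetD transpose_apply_first transpose_apply_other transpose_apply_second)

lemma sum_ksub_sw:
  assumes "i \<in> N" "j \<in> N"
  shows "(\<Sum>X\<in>ksub N k. g (sw i j X)) = (\<Sum>X\<in>ksub N k. g X)"
  by (rule sum.reindex_bij_witness[of _ "sw i j" "sw i j"]) (use assms sw_ksub in auto)

lemma sw_conj: "sw a b (sw i j X) = sw (Transposition.transpose a b i) (Transposition.transpose a b j) (sw a b X)"
proof -
  have "Transposition.transpose a b \<circ> Transposition.transpose i j
      = Transposition.transpose (Transposition.transpose a b i) (Transposition.transpose a b j)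
        \<circ> Transposition.transpose a b"
    by (auto simp: fun_eq_iff Transposition.transpose_def)
  then show ?thesis by (metis image_comp sw_def)
qed

text \<open>A transposition moves X only if exactly one of i, j lies in X, and then it exchanges an
  element a of X for some b outside. Both (a, b) and (b, a) perform the same exchange, hence the
  factor 2.\<close>

lemma sum_swaps_eq_edge_sum:
  assumes fin: "finite N" and psi0: "\<And>u. \<psi> u u = (0::real)"
  shows "(\<Sum>X\<in>ksub N (Suc r). \<Sum>i\<in>N. \<Sum>j\<in>N. \<psi> (f X) (f (sw i j X))) = 2 * edge_sum \<psi> N r f"
proof -
  define h where "h a Z = (\<Sum>b\<in>N - (Z - {a}). \<psi> (f Z) (f (insert b (Z - {a}))))" for a Z
  have "edge_sum \<psi> N r f = (\<Sum>a\<in>N. \<Sum>Y\<in>ksub (N - {a}) r. \<Sum>b\<in>N - Y. \<psi> (f (insert a Y)) (f (insert b Y)))"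
    unfolding edge_sum_def by (rule sum_ksub_remove[OF fin, symmetric])
  also have "\<dots> = (\<Sum>a\<in>N. \<Sum>Y\<in>ksub (N - {a}) r. h a (insert a Y))"
  proof (intro sum.cong refl)
    fix a Y assume "Y \<in> ksub (N - {a}) r"
    then have "insert a Y - {a} = Y" by (auto simp: ksub_def)
    then show "(\<Sum>b\<in>N - Y. \<psi> (f (insert a Y)) (f (insert b Y))) = h a (insert a Y)"
      by (simp add: h_def)
  qed
  also have "\<dots> = (\<Sum>Z\<in>ksub N (Suc r). \<Sum>a\<in>Z. h a Z)"
    by (rule sum_ksub_insert[OF fin])
  finally have edge: "edge_sum \<psi> N r f = (\<Sum>Z\<in>ksub N (Suc r). \<Sum>a\<in>Z. h a Z)" .
  have "(\<Sum>i\<in>N. \<Sum>j\<in>N. \<psi> (f Z) (f (sw i j Z))) = 2 * (\<Sum>a\<in>Z. h a Z)" if Z: "Z \<in> ksub N (Suc r)" for Z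
  proof -
    have ZN: "Z \<subseteq> N" using Z by (auto simp: ksub_def)
    have fZ: "finite Z" using ZN fin finite_subset by blast
    define q where "q i j = \<psi> (f Z) (f (sw i j Z))" for i j
    have q0: "q i j = 0" if "i \<in> Z \<longleftrightarrow> j \<in> Z" for i j
      using that psi0 by (simp add: q_def sw_id)
    have h: "h a Z = (\<Sum>b\<in>N - Z. q a b)" if a: "a \<in> Z" for a
    proof -
      have "N - (Z - {a}) = insert a (N - Z)" using a ZN by auto
      then have "h a Z = \<psi> (f Z) (f (insert a (Z - {a}))) + (\<Sum>b\<in>N - Z. \<psi> (f Z) (f (insert b (Z - {a}))))"
        unfolding h_def using a fin by simp
      also have "insert a (Z - {a}) = Z" using a by auto
      also have "(\<Sum>b\<in>N - Z. \<psi> (f Z) (f (insert b (Z - {a})))) = (\<Sum>b\<in>N - Z. q a b)"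
        using a by (intro sum.cong refl) (simp add: q_def sw_exchange)
      finally show ?thesis using psi0 by simp
    qed
    have N: "(\<Sum>j\<in>N. g j) = (\<Sum>j\<in>Z. g j) + (\<Sum>j\<in>N - Z. g j)" for g :: "'a \<Rightarrow> real"
      using sum.subset_diff[OF ZN fin, of g] by simp
    have 1: "(\<Sum>j\<in>N. q i j) = (\<Sum>j\<in>N - Z. q i j)" if "i \<in> Z" for i
      unfolding N[of "q i"] using q0 that by (simp add: sum.neutral)
    have 2: "(\<Sum>j\<in>N. q i j) = (\<Sum>j\<in>Z. q j i)" if "i \<in> N - Z" for i
      unfolding N[of "q i"] using q0 that by (simp add: sum.neutral q_def sw_commute)
    have "(\<Sum>i\<in>N. \<Sum>j\<in>N. q i j) = (\<Sum>i\<in>Z. \<Sum>j\<in>N - Z. q i j) + (\<Sum>i\<in>N - Z. \<Sum>j\<in>Z. q j i)"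
      unfolding N[of "\<lambda>i. \<Sum>j\<in>N. q i j"] using 1 2 by simp
    also have "\<dots> = 2 * (\<Sum>a\<in>Z. \<Sum>b\<in>N - Z. q a b)"
      using sum.swap[of q "N - Z" Z] by simp
    also have "\<dots> = 2 * (\<Sum>a\<in>Z. h a Z)" using h by simp
    finally show ?thesis by (simp add: q_def)
  qed
  then show ?thesis unfolding edge by (simp add: sum_distrib_left)
qed

lemma sum_swap3:
  "(\<Sum>X\<in>A. \<Sum>i\<in>B. \<Sum>j\<in>C. g X i j) = (\<Sum>i\<in>B. \<Sum>j\<in>C. \<Sum>X\<in>A. g X i j)"
proof -
  have "(\<Sum>X\<in>A. \<Sum>i\<in>B. \<Sum>j\<in>C. g X i j) = (\<Sum>i\<in>B. \<Sum>X\<in>A. \<Sum>j\<in>C. g X i j)"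
    by (rule sum.swap)
  also have "\<dots> = (\<Sum>i\<in>B. \<Sum>j\<in>C. \<Sum>X\<in>A. g X i j)"
    by (intro sum.cong refl sum.swap)
  finally show ?thesis .
qed

section \<open>The lazy random transposition walk and its decay\<close>

locale slice_space =
  fixes N :: "'a set" and k :: nat
  assumes fin: "finite N" and k_pos: "0 < k" and k_lt: "k < card N"
begin

abbreviation \<Omega> where "\<Omega> \<equiv> ksub N k"
abbreviation n where "n \<equiv> real (card N)"

definition E :: "('a set \<Rightarrow> real) \<Rightarrow> real" where "E f = kmean N k f"
definition D :: "'a \<Rightarrow> 'a \<Rightarrow> ('a set \<Rightarrow> real) \<Rightarrow> 'a set \<Rightarrow> real" where "D i j f X = f (sw i j X) - f X"
definition infl :: "'a \<Rightarrow> 'a \<Rightarrow> ('a set \<Rightarrow> real) \<Rightarrow> real" where "infl i j f = E (\<lambda>X. \<bar>D i j f X\<bar>)"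
text \<open>The sum runs over ordered pairs and so meets each transposition twice; the 2 in the
  denominator makes this the total influence of the problem. The same normalization is used for
  \<open>energy\<close>.\<close>

definition tot :: "('a set \<Rightarrow> real) \<Rightarrow> real" where "tot f = (\<Sum>i\<in>N. \<Sum>j\<in>N. infl i j f) / (2 * n)"
definition energy :: "('a set \<Rightarrow> real) \<Rightarrow> real" where
  "energy f = (\<Sum>i\<in>N. \<Sum>j\<in>N. E (\<lambda>X. (D i j f X)\<^sup>2)) / (2 * n)"
definition T :: "('a set \<Rightarrow> real) \<Rightarrow> 'a set \<Rightarrow> real" where
  "T f X = (\<Sum>i\<in>N. \<Sum>j\<in>N. (f X + f (sw i j X)) / 2) / n\<^sup>2"
definition lsc :: real where "lsc = 2 * (n / real k + n / (n - real k))"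

lemma card_pos: "real (card \<Omega>) > 0"
  using fin k_lt by (simp add: card_ksub)

lemma n_pos: "n > 0" using k_lt by simp

lemma E_alt: "E f = (\<Sum>X\<in>\<Omega>. f X) / real (card \<Omega>)"
  by (simp add: E_def kmean_def)

lemma E_cong: "(\<And>X. X \<in> \<Omega> \<Longrightarrow> f X = g X) \<Longrightarrow> E f = E g"
  by (simp add: E_alt)

lemma E_mono: "(\<And>X. X \<in> \<Omega> \<Longrightarrow> f X \<le> g X) \<Longrightarrow> E f \<le> E g"
  unfolding E_alt by (intro divide_right_mono sum_mono) auto

lemma E_add: "E (\<lambda>X. f X + g X) = E f + E g"
  by (simp add: E_alt sum.distrib add_divide_distrib)

lemma E_diff: "E (\<lambda>X. f X - g X) = E f - E g"
  by (simp add: E_alt sum_subtractf diff_divide_distrib)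

lemma E_cmult: "E (\<lambda>X. c * f X) = c * E f"
  by (simp add: E_alt flip: sum_distrib_left)

lemma E_divide: "E (\<lambda>X. f X / c) = E f / c"
  by (simp add: E_alt flip: sum_divide_distrib)

lemma E_const [simp]: "E (\<lambda>X. c) = c"
  using card_pos by (simp add: E_alt)

lemma E_nonneg: "(\<And>X. X \<in> \<Omega> \<Longrightarrow> 0 \<le> f X) \<Longrightarrow> 0 \<le> E f"
  using E_mono[of "\<lambda>_. 0" f] by simp

lemma E_sum: "E (\<lambda>X. \<Sum>i\<in>A. f i X) = (\<Sum>i\<in>A. E (f i))"
  unfolding E_alt by (subst sum.swap) (simp add: sum_divide_distrib)

lemma E_sw: "i \<in> N \<Longrightarrow> j \<in> N \<Longrightarrow> E (\<lambda>X. f (sw i j X)) = E f"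
  unfolding E_alt by (simp add: sum_ksub_sw)

lemma infl_nonneg: "0 \<le> infl i j f"
  unfolding infl_def by (rule E_nonneg) simp

lemma tot_nonneg: "0 \<le> tot f"
  unfolding tot_def by (intro divide_nonneg_nonneg sum_nonneg infl_nonneg) auto

lemma energy_nonneg: "0 \<le> energy f"
  unfolding energy_def by (intro divide_nonneg_nonneg sum_nonneg E_nonneg) auto

lemma edge_sum_eq:
  assumes "\<And>u. \<psi> u u = 0"
  shows "edge_sum \<psi> N (k - 1) f / real (card \<Omega>) = (\<Sum>i\<in>N. \<Sum>j\<in>N. E (\<lambda>X. \<psi> (f X) (f (sw i j X)))) / 2"
proof -
  have "2 * edge_sum \<psi> N (k - 1) f = (\<Sum>X\<in>\<Omega>. \<Sum>i\<in>N. \<Sum>j\<in>N. \<psi> (f X) (f (sw i j X)))"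
    using sum_swaps_eq_edge_sum[where \<psi> = \<psi> and r = "k - 1" and f = f, OF fin assms] k_pos by simp
  also have "\<dots> = (\<Sum>i\<in>N. \<Sum>j\<in>N. \<Sum>X\<in>\<Omega>. \<psi> (f X) (f (sw i j X)))"
    by (rule sum_swap3)
  also have "\<dots> = real (card \<Omega>) * (\<Sum>i\<in>N. \<Sum>j\<in>N. E (\<lambda>X. \<psi> (f X) (f (sw i j X))))"
    using card_pos by (simp add: E_alt flip: sum_divide_distrib)
  finally show ?thesis using card_pos by (simp add: field_simps)
qed

lemma mean_deviation_le_tot: "E (\<lambda>X. \<bar>f X - E f\<bar>) \<le> 2 * tot f"
proof -
  have "L1_dev N k f \<le> 2 / n * edge_sum (\<lambda>u v. \<bar>u - v\<bar>) N (k - 1) f"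
    using L1_poincare[OF fin, of "k - 1" f] k_pos by simp
  then have "L1_dev N k f / real (card \<Omega>) \<le> 2 / n * (edge_sum (\<lambda>u v. \<bar>u - v\<bar>) N (k - 1) f / real (card \<Omega>))"
    unfolding times_divide_eq_right by (rule divide_right_mono) simp
  also have "\<dots> = 2 * tot f"
    by (subst edge_sum_eq) (auto simp: tot_def infl_def D_def abs_minus_commute)
  finally show ?thesis by (simp add: L1_dev_def E_alt kmean_def)
qed

lemma ent_le_energy: "E (\<lambda>X. (u X)\<^sup>2 * ln ((u X)\<^sup>2)) - E (\<lambda>X. (u X)\<^sup>2) * ln (E (\<lambda>X. (u X)\<^sup>2)) \<le> lsc * energy u"
proof -
  have "ent_sq N k u \<le> lsc / n * edge_sum (\<lambda>u v. (u - v)\<^sup>2) N (k - 1) u"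
    using log_sobolev[OF fin, of "k - 1" u] k_pos k_lt by (simp add: lsc_def)
  then have "ent_sq N k u / real (card \<Omega>) \<le> lsc / n * (edge_sum (\<lambda>u v. (u - v)\<^sup>2) N (k - 1) u / real (card \<Omega>))"
    unfolding times_divide_eq_right by (rule divide_right_mono) simp
  also have "\<dots> = lsc * energy u"
    by (subst edge_sum_eq) (auto simp: energy_def D_def power2_commute)
  finally show ?thesis by (simp add: ent_sq_def E_alt kmean_def diff_divide_distrib)
qed

lemma lsc_ge: "lsc \<ge> 4"
proof -
  have "n / real k \<ge> 1" "n / (n - real k) \<ge> 1"
    using k_lt k_pos by (auto simp: field_simps)
  then show ?thesis by (simp add: lsc_def)
qed

lemma T_alt: "T f X = (\<Sum>p\<in>N \<times> N. (f X + f (sw (fst p) (snd p) X)) / 2) / n\<^sup>2"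
  by (simp add: T_def sum.cartesian_product case_prod_beta)

lemma T_split: "T f X = f X / 2 + (\<Sum>i\<in>N. \<Sum>j\<in>N. f (sw i j X)) / (2 * n\<^sup>2)"
proof -
  have "(\<Sum>i\<in>N. \<Sum>j\<in>N. (f X + f (sw i j X)) / 2) = (n\<^sup>2 * f X + (\<Sum>i\<in>N. \<Sum>j\<in>N. f (sw i j X))) / 2"
    by (simp add: sum.distrib power2_eq_square flip: sum_divide_distrib)
  then show ?thesis
    using n_pos by (simp add: T_def add_divide_distrib)
qed

text \<open>Conjugation by a transposition permutes the set of all transpositions, so their average
  is unaffected. Thus smoothing f smooths each difference of f, and decay estimates can be applied
  to the differences themselves.\<close>

lemma T_D:
  assumes ab: "a \<in> N" "b \<in> N"
  shows "T (D a b f) = D a b (T f)"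
proof
  fix X
  let ?\<pi> = "Transposition.transpose a b"
  have bij: "bij_betw ?\<pi> N N" using ab by (simp add: bij_betw_def)
  have "(\<Sum>i\<in>N. \<Sum>j\<in>N. f (sw a b (sw i j X))) = (\<Sum>i\<in>N. \<Sum>j\<in>N. f (sw (?\<pi> i) (?\<pi> j) (sw a b X)))"
    by (intro sum.cong refl arg_cong[where f = f] sw_conj)
  also have "\<dots> = (\<Sum>i\<in>N. \<Sum>j\<in>N. f (sw (?\<pi> i) j (sw a b X)))"
    by (intro sum.cong refl sum.reindex_bij_betw[OF bij])
  also have "\<dots> = (\<Sum>i\<in>N. \<Sum>j\<in>N. f (sw i j (sw a b X)))"
    by (rule sum.reindex_bij_betw[OF bij])
  finally show "T (D a b f) X = D a b (T f) X"
    by (simp add: T_split D_def sum_subtractf diff_divide_distrib)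
qed

lemma abs_T_le: "\<bar>T f X\<bar> \<le> T (\<lambda>X. \<bar>f X\<bar>) X"
  unfolding T_alt abs_divide
  by (intro divide_mono order_trans[OF sum_abs] sum_mono) (use n_pos in auto)

lemma E_T: "E (T f) = E f"
proof -
  have "E (T f) = (\<Sum>i\<in>N. \<Sum>j\<in>N. E (\<lambda>X. (f X + f (sw i j X)) / 2)) / n\<^sup>2"
    unfolding T_def E_divide by (simp add: E_sum E_divide)
  also have "\<dots> = (\<Sum>i\<in>N. \<Sum>j\<in>N. E f) / n\<^sup>2"
    by (simp add: E_divide E_add E_sw)
  also have "\<dots> = E f" using n_pos by (simp add: power2_eq_square)
  finally show ?thesis .
qed

lemma T_L1: "E (\<lambda>X. \<bar>T f X\<bar>) \<le> E (\<lambda>X. \<bar>f X\<bar>)"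
  using E_mono[of "\<lambda>X. \<bar>T f X\<bar>" "T (\<lambda>X. \<bar>f X\<bar>)"] abs_T_le E_T[of "\<lambda>X. \<bar>f X\<bar>"] by simp

text \<open>Each \<open>(I + \<tau>) / 2\<close> is an orthogonal projection, so its energy loss is exact; T averages them.\<close>

lemma T_energy: "E (\<lambda>X. (T u X)\<^sup>2) \<le> E (\<lambda>X. (u X)\<^sup>2) - energy u / (2 * n)"
proof -
  have "(T u X)\<^sup>2 \<le> (\<Sum>i\<in>N. \<Sum>j\<in>N. ((u X + u (sw i j X)) / 2)\<^sup>2) / n\<^sup>2" for X
  proof -
    let ?g = "\<lambda>p. (u X + u (sw (fst p) (snd p) X)) / 2"
    have "(\<Sum>p\<in>N \<times> N. ?g p)\<^sup>2 \<le> n\<^sup>2 * (\<Sum>p\<in>N \<times> N. (?g p)\<^sup>2)"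
      using Cauchy_Schwarz_ineq_sum[of "\<lambda>_. 1" ?g "N \<times> N"]
      by (simp add: power2_eq_square card_cartesian_product)
    then have "(\<Sum>p\<in>N \<times> N. ?g p)\<^sup>2 / (n\<^sup>2 * n\<^sup>2) \<le> n\<^sup>2 * (\<Sum>p\<in>N \<times> N. (?g p)\<^sup>2) / (n\<^sup>2 * n\<^sup>2)"
      by (rule divide_right_mono) simp
    then have "(T u X)\<^sup>2 \<le> (\<Sum>p\<in>N \<times> N. (?g p)\<^sup>2) / n\<^sup>2"
      unfolding T_alt power_divide using n_pos by (simp add: power2_eq_square)
    then show ?thesis by (simp add: sum.cartesian_product case_prod_beta)
  qed
  then have "E (\<lambda>X. (T u X)\<^sup>2) \<le> E (\<lambda>X. (\<Sum>i\<in>N. \<Sum>j\<in>N. ((u X + u (sw i j X)) / 2)\<^sup>2) / n\<^sup>2)"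
    by (intro E_mono) auto
  also have "\<dots> = (\<Sum>i\<in>N. \<Sum>j\<in>N. E (\<lambda>X. ((u X + u (sw i j X)) / 2)\<^sup>2)) / n\<^sup>2"
    by (simp only: E_divide E_sum)
  also have "\<dots> = (\<Sum>i\<in>N. \<Sum>j\<in>N. E (\<lambda>X. (u X)\<^sup>2) - E (\<lambda>X. (D i j u X)\<^sup>2) / 4) / n\<^sup>2"
  proof (intro arg_cong2[where f = "(/)"] sum.cong refl)
    fix i j assume "i \<in> N" "j \<in> N"
    have "E (\<lambda>X. ((u X + u (sw i j X)) / 2)\<^sup>2)
        = E (\<lambda>X. ((u X)\<^sup>2 + (u (sw i j X))\<^sup>2) / 2 - (D i j u X)\<^sup>2 / 4)"
      by (intro E_cong) (simp add: D_def power2_eq_square field_simps)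
    also have "\<dots> = E (\<lambda>X. (u X)\<^sup>2) - E (\<lambda>X. (D i j u X)\<^sup>2) / 4"
      using E_sw[OF \<open>i \<in> N\<close> \<open>j \<in> N\<close>, of "\<lambda>X. (u X)\<^sup>2"] by (simp add: E_diff E_divide E_add)
    finally show "E (\<lambda>X. ((u X + u (sw i j X)) / 2)\<^sup>2) = E (\<lambda>X. (u X)\<^sup>2) - E (\<lambda>X. (D i j u X)\<^sup>2) / 4" .
  qed
  also have "\<dots> = E (\<lambda>X. (u X)\<^sup>2) - energy u / (2 * n)"
    using n_pos
    by (simp add: energy_def sum_subtractf diff_divide_distrib power2_eq_square flip: sum_divide_distrib)
  finally show ?thesis .
qed

text \<open>Jensen's inequality for the logarithm under the density
  \<open>(u X)\<^sup>2 / y\<close>: the mean of 1/|u| under it is the L1 norm divided by y. The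
  proof integrates the corresponding tangent-line bound, which touches at |u| = y/\<eta>.\<close>

lemma ent_lower:
  assumes "\<eta> > 0" "E (\<lambda>X. \<bar>u X\<bar>) \<le> \<eta>" and y: "y = E (\<lambda>X. (u X)\<^sup>2)" "y > 0"
  shows "E (\<lambda>X. (u X)\<^sup>2 * ln ((u X)\<^sup>2)) - y * ln y \<ge> y * ln (y / \<eta>\<^sup>2)"
proof -
  have pt: "(u X)\<^sup>2 * (2 * ln (y / \<eta>)) + 2 * (u X)\<^sup>2 - 2 * y / \<eta> * \<bar>u X\<bar> \<le> (u X)\<^sup>2 * ln ((u X)\<^sup>2)" for X
  proof (cases "u X = 0")
    case False
    define w where "w = \<bar>u X\<bar>"
    have w: "w > 0" using False by (simp add: w_def)
    have "ln (y / (\<eta> * w)) \<le> y / (\<eta> * w) - 1"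
      using w assms y by (intro ln_le_minus_one) auto
    then have "ln (y / \<eta>) + 1 - y / (\<eta> * w) \<le> ln w"
      using w assms(1) y(2) by (simp add: ln_div ln_mult)
    then have "2 * w\<^sup>2 * (ln (y / \<eta>) + 1 - y / (\<eta> * w)) \<le> 2 * w\<^sup>2 * ln w"
      by (intro mult_left_mono) auto
    also have "2 * w\<^sup>2 * ln w = (u X)\<^sup>2 * ln ((u X)\<^sup>2)"
      proof -
      have "(u X)\<^sup>2 = w\<^sup>2" by (simp add: w_def)
      then show ?thesis using w by (simp add: ln_realpow)
    qed
    finally show ?thesis
      using w assms(1) by (simp add: w_def[symmetric] power2_eq_square algebra_simps)
        (simp add: w_def flip: abs_mult)
  qed simp
  have "y * (2 * ln (y / \<eta>)) + 2 * y - 2 * y / \<eta> * E (\<lambda>X. \<bar>u X\<bar>)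
      = E (\<lambda>X. (2 * ln (y / \<eta>)) * (u X)\<^sup>2 + 2 * (u X)\<^sup>2 - 2 * y / \<eta> * \<bar>u X\<bar>)"
    by (simp only: E_diff E_add E_cmult y(1)[symmetric]) simp
  also have "\<dots> \<le> E (\<lambda>X. (u X)\<^sup>2 * ln ((u X)\<^sup>2))"
    by (rule E_mono) (use pt in \<open>simp add: mult_ac\<close>)
  finally have "y * (2 * ln (y / \<eta>)) + 2 * y - 2 * y / \<eta> * E (\<lambda>X. \<bar>u X\<bar>) \<le> E (\<lambda>X. (u X)\<^sup>2 * ln ((u X)\<^sup>2))" .
  moreover have "2 * y / \<eta> * E (\<lambda>X. \<bar>u X\<bar>) \<le> 2 * y / \<eta> * \<eta>"
    using assms by (intro mult_left_mono) auto
  moreover have "y * (2 * ln (y / \<eta>)) = y * ln (y / \<eta>\<^sup>2) + y * ln y"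
    using assms by (simp add: ln_div power2_eq_square ln_mult algebra_simps)
  ultimately show ?thesis using assms(1) by simp
qed

definition rate :: real where "rate = 1 / (2 * n * lsc)"

lemma rate_bounds: "0 < rate" "rate < 1"
proof -
  have "2 * n * lsc > 1"
  proof -
    have "2 * n \<ge> 2" using k_lt by simp
    then have "2 * n * lsc \<ge> 2 * 4" using lsc_ge by (intro mult_mono) auto
    then show ?thesis by simp
  qed
  then show "0 < rate" "rate < 1" by (auto simp: rate_def)
qed

text \<open>A Nash-type step: log-Sobolev gives \<open>y' \<le> y * (1 - rate * ln (y / \<eta>\<^sup>2))\<close> for the squared L2 norm \<open>y\<close>.\<close>

lemma T_step:
  assumes "\<eta> > 0" "E (\<lambda>X. \<bar>u X\<bar>) \<le> \<eta>"
  shows "E (\<lambda>X. (T u X)\<^sup>2) \<le> E (\<lambda>X. (u X)\<^sup>2) powr (1 - rate) * (\<eta>\<^sup>2) powr rate"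
proof -
  define y where "y = E (\<lambda>X. (u X)\<^sup>2)"
  have y0: "y \<ge> 0" unfolding y_def by (rule E_nonneg) simp
  show ?thesis
  proof (cases "y = 0")
    case True
    have "E (\<lambda>X. (T u X)\<^sup>2) \<le> y" 
      using T_energy[of u] divide_nonneg_nonneg[OF energy_nonneg[of u], of "2 * n"] by (simp add: y_def)
    then show ?thesis using True by (simp add: y_def)
  next
    case False
    then have yp: "y > 0" using y0 by simp
    have "y * ln (y / \<eta>\<^sup>2) \<le> lsc * energy u"
      using ent_lower[OF assms y_def yp] ent_le_energy[of u] by (simp add: y_def)
    then have "rate * (y * ln (y / \<eta>\<^sup>2)) \<le> rate * (lsc * energy u)"
      using rate_bounds by (intro mult_left_mono) auto
    also have "\<dots> = energy u / (2 * n)"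
      using lsc_ge by (simp add: rate_def)
    finally have "E (\<lambda>X. (T u X)\<^sup>2) \<le> y * (1 + - rate * ln (y / \<eta>\<^sup>2))"
      using T_energy[of u] by (simp add: y_def algebra_simps)
    also have "\<dots> \<le> y * exp (- rate * ln (y / \<eta>\<^sup>2))"
      using yp by (intro mult_left_mono exp_ge_add_one_self) simp
    also have "\<dots> = y powr (1 - rate) * (\<eta>\<^sup>2) powr rate"
      using yp assms(1) by (simp add: powr_def ln_div algebra_simps exp_diff exp_add divide_simps)
    finally show ?thesis by (simp add: y_def)
  qed
qed

lemma T_iter_L1: "E (\<lambda>X. \<bar>(T ^^ m) u X\<bar>) \<le> E (\<lambda>X. \<bar>u X\<bar>)"
proof (induction m)
  case (Suc m)
  then show ?case using T_L1[of "(T ^^ m) u"] by simp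
qed simp

text \<open>T contracts the L1 norm, so the same \<eta> remains valid along the whole iteration and
  every step multiplies the exponent of Q by \<open>1 - rate\<close>.\<close>

lemma T_iter_decay:
  assumes "\<eta> > 0" "E (\<lambda>X. \<bar>u X\<bar>) \<le> \<eta>" "Q > 0" "E (\<lambda>X. (u X)\<^sup>2) \<le> \<eta>\<^sup>2 * Q"
  shows "E (\<lambda>X. ((T ^^ m) u X)\<^sup>2) \<le> \<eta>\<^sup>2 * Q powr ((1 - rate) ^ m)"
proof (induction m)
  case 0
  then show ?case using assms by simp
next
  case (Suc m)
  have "E (\<lambda>X. ((T ^^ Suc m) u X)\<^sup>2) \<le> E (\<lambda>X. ((T ^^ m) u X)\<^sup>2) powr (1 - rate) * (\<eta>\<^sup>2) powr rate"
    using T_step[OF assms(1) order_trans[OF T_iter_L1 assms(2)], of m] by simp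
  also have "\<dots> \<le> (\<eta>\<^sup>2 * Q powr ((1 - rate) ^ m)) powr (1 - rate) * (\<eta>\<^sup>2) powr rate"
    using Suc rate_bounds by (intro mult_right_mono powr_mono2 E_nonneg) auto
  also have "\<dots> = \<eta>\<^sup>2 * Q powr ((1 - rate) ^ Suc m)"
    using assms by (simp add: powr_mult powr_powr mult_ac flip: powr_add)
  finally show ?case .
qed

text \<open>Decay is applied with \<eta> the L1 norm I of u and Q = B/I, giving B * I times a power
  of I/B. Only this power is estimated by \<rho>; the factor I is retained because for u =
  \<open>D i j f\<close> it is an influence, and these add up to the total influence.\<close>

lemma T_iter_small:
  assumes "B > 0" "\<And>X. X \<in> \<Omega> \<Longrightarrow> \<bar>u X\<bar> \<le> B" and small: "E (\<lambda>X. \<bar>u X\<bar>) \<le> B * \<rho>"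
  shows "E (\<lambda>X. ((T ^^ m) u X)\<^sup>2) \<le> B * E (\<lambda>X. \<bar>u X\<bar>) * \<rho> powr (1 - (1 - rate) ^ m)"
proof -
  define I where "I = E (\<lambda>X. \<bar>u X\<bar>)"
  have I0: "I \<ge> 0" unfolding I_def by (rule E_nonneg) simp
  have sq: "E (\<lambda>X. (u X)\<^sup>2) \<le> B * I"
    unfolding I_def E_cmult[symmetric]
    by (rule E_mono) (use assms(2) in \<open>metis abs_ge_zero abs_mult_self_eq mult_right_mono power2_eq_square\<close>)
  show ?thesis
  proof (cases "I = 0")
    \<comment> \<open>Decay needs a positive \<eta>. If the L1 norm is 0, so is the squared L2 norm,
      and T does not increase the latter.\<close>
    case True
    have "E (\<lambda>X. ((T ^^ m) u X)\<^sup>2) \<le> E (\<lambda>X. (u X)\<^sup>2)"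
    proof (induction m)
      case (Suc m)
      have "energy ((T ^^ m) u) / (2 * n) \<ge> 0" using energy_nonneg n_pos by simp
      then show ?case using Suc T_energy[of "(T ^^ m) u"] by simp
    qed simp
    then show ?thesis using sq True by (simp add: I_def)
  next
    case False
    then have Ip: "I > 0" using I0 by simp
    define t where "t = (1 - rate) ^ m"
    have t: "t \<le> 1" using rate_bounds by (simp add: t_def power_le_one)
    have "E (\<lambda>X. ((T ^^ m) u X)\<^sup>2) \<le> I\<^sup>2 * (B / I) powr t"
      unfolding t_def using Ip sq assms(1)
      by (intro T_iter_decay) (auto simp: I_def[symmetric] power2_eq_square mult_ac)
    also have "\<dots> = B * I * (I / B) powr (1 - t)"
      using Ip assms(1) by (simp add: powr_divide powr_diff power2_eq_square field_simps)
    also have "\<dots> \<le> B * I * \<rho> powr (1 - t)"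
      using Ip assms t by (intro mult_left_mono powr_mono2) (auto simp: I_def field_simps)
    finally show ?thesis by (simp add: t_def I_def)
  qed
qed

section \<open>The L1 cost of smoothing\<close>

lemma T_diff: "T (\<lambda>X. f X - g X) = (\<lambda>X. T f X - T g X)"
  by (simp add: T_split sum_subtractf diff_divide_distrib fun_eq_iff)

lemma T_approx: "E (\<lambda>X. \<bar>f X - T f X\<bar>) \<le> tot f / n"
proof -
  have "\<bar>f X - T f X\<bar> \<le> (\<Sum>i\<in>N. \<Sum>j\<in>N. \<bar>D i j f X\<bar> / 2) / n\<^sup>2" for X
  proof -
    have "T f X - f X = (\<Sum>i\<in>N. \<Sum>j\<in>N. D i j f X / 2) / n\<^sup>2"
      using n_pos
      by (simp add: T_split D_def sum_subtractf diff_divide_distrib power2_eq_square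
          flip: sum_divide_distrib)
    then have "\<bar>f X - T f X\<bar> = \<bar>\<Sum>i\<in>N. \<Sum>j\<in>N. D i j f X / 2\<bar> / n\<^sup>2"
      by (simp add: abs_minus_commute[of "f X"])
    also have "\<dots> \<le> (\<Sum>i\<in>N. \<Sum>j\<in>N. \<bar>D i j f X / 2\<bar>) / n\<^sup>2"
      by (intro divide_right_mono order_trans[OF sum_abs] sum_mono sum_abs) auto
    finally show ?thesis by simp
  qed
  then have "E (\<lambda>X. \<bar>f X - T f X\<bar>) \<le> E (\<lambda>X. (\<Sum>i\<in>N. \<Sum>j\<in>N. \<bar>D i j f X\<bar> / 2) / n\<^sup>2)"
    by (intro E_mono) auto
  also have "\<dots> = tot f / n"
    by (simp only: E_divide E_sum infl_def[symmetric])
      (simp add: tot_def power2_eq_square flip: sum_divide_distrib)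
  finally show ?thesis .
qed

text \<open>Telescoping: each further step changes the iterate by the image of
  \<open>f - T f\<close> under an L1 contraction. The cost is linear in m, which limits the number
  of steps to a small multiple of n.\<close>

lemma T_iter_approx: "E (\<lambda>X. \<bar>f X - (T ^^ m) f X\<bar>) \<le> real m * tot f / n"
proof (induction m)
  case (Suc m)
  have *: "E (\<lambda>X. \<bar>(T ^^ m) f X - (T ^^ m) (T f) X\<bar>) \<le> tot f / n"
  proof -
    have "(T ^^ m) (\<lambda>X. f X - g X) = (\<lambda>X. (T ^^ m) f X - (T ^^ m) g X)" for f g
      by (induction m) (simp_all add: T_diff)
    then show ?thesis
      using T_iter_L1[of m "\<lambda>X. f X - T f X"] T_approx[of f] by simp
  qed
  have "E (\<lambda>X. \<bar>f X - (T ^^ Suc m) f X\<bar>)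
      \<le> E (\<lambda>X. \<bar>f X - (T ^^ m) f X\<bar> + \<bar>(T ^^ m) f X - (T ^^ m) (T f) X\<bar>)"
    by (intro E_mono) (simp add: funpow_swap1)
  also have "\<dots> \<le> real m * tot f / n + tot f / n"
    unfolding E_add using Suc * by simp
  finally show ?case by (simp add: add_divide_distrib distrib_right)
qed simp

lemma T_iter_D: "a \<in> N \<Longrightarrow> b \<in> N \<Longrightarrow> (T ^^ m) (D a b f) = D a b ((T ^^ m) f)"
  by (induction m) (simp_all add: T_D)

end

section \<open>Approximation by juntas\<close>

lemma sum_ksub_fibers:
  assumes "finite N" "S \<subseteq> N"
  shows "(\<Sum>X\<in>ksub N k. q X)
    = (\<Sum>Z\<in>{Z. Z \<subseteq> S \<and> card Z \<le> k}. \<Sum>Y\<in>ksub (N - S) (k - card Z). q (Z \<union> Y))"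
proof -
  have fS: "finite S" using assms finite_subset by blast
  then have fZ: "finite {Z. Z \<subseteq> S \<and> card Z \<le> k}" by simp
  have "(\<Sum>Z\<in>{Z. Z \<subseteq> S \<and> card Z \<le> k}. \<Sum>Y\<in>ksub (N - S) (k - card Z). q (Z \<union> Y))
    = (\<Sum>(Z, Y)\<in>Sigma {Z. Z \<subseteq> S \<and> card Z \<le> k} (\<lambda>Z. ksub (N - S) (k - card Z)). q (Z \<union> Y))"
    using fZ assms by (intro sum.Sigma) auto
  also have "\<dots> = (\<Sum>X\<in>ksub N k. q X)"
  proof (rule sum.reindex_bij_witness[of _ "\<lambda>X. (X \<inter> S, X - S)" "\<lambda>(Z, Y). Z \<union> Y"])
    fix p assume "p \<in> Sigma {Z. Z \<subseteq> S \<and> card Z \<le> k} (\<lambda>Z. ksub (N - S) (k - card Z))"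
    then obtain Z Y where p [simp]: "p = (Z, Y)" and Z: "Z \<subseteq> S" "card Z \<le> k"
      and Y: "Y \<subseteq> N - S" "card Y = k - card Z"
      by (auto simp: ksub_def)
    have "finite Z" "finite Y" using Z Y fS assms(1) by (meson finite_Diff finite_subset)+
    moreover have "Z \<inter> Y = {}" using Z Y by auto
    ultimately show "(case p of (Z, Y) \<Rightarrow> Z \<union> Y) \<in> ksub N k"
      using Z Y assms(2) by (auto simp: ksub_def card_Un_disjoint)
    show "((case p of (Z, Y) \<Rightarrow> Z \<union> Y) \<inter> S, (case p of (Z, Y) \<Rightarrow> Z \<union> Y) - S) = p"
      using Z Y by auto
  next
    fix X assume X: "X \<in> ksub N k"
    then have fX: "finite X" using assms(1) by (rule finite_of_ksub[rotated])
    have "card (X \<inter> S) + card (X - S) = k"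
      using X fX by (metis (mono_tags, lifting) card_Int_Diff ksub_def mem_Collect_eq)
    then show "(X \<inter> S, X - S) \<in> Sigma {Z. Z \<subseteq> S \<and> card Z \<le> k} (\<lambda>Z. ksub (N - S) (k - card Z))"
      using X by (auto simp: ksub_def)
  qed auto
  finally show ?thesis by simp
qed

text \<open>The heights form a geometric series, so the topmost layer reached by x accounts for the
  sum up to a factor 2, and its height is less than x + 1.\<close>

lemma sum_layer_heights:
  fixes x :: real
  assumes "0 \<le> x"
  shows "(\<Sum>l<J. 2 ^ l * of_bool (2 ^ l - 1 < x)) \<le> 1 + 2 * x"
proof (induction J)
  case (Suc J)
  show ?case
  proof (cases "2 ^ J - 1 < x")
    case True
    have "(\<Sum>l<Suc J. 2 ^ l * of_bool (2 ^ l - 1 < x)) \<le> (\<Sum>l<Suc J. (2::real) ^ l)"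
      by (intro sum_mono) auto
    also have "\<dots> = 2 * 2 ^ J - 1"
      using geometric_sum[of "2::real" "Suc J"] by simp
    finally show ?thesis using True by simp
  qed (use Suc in simp)
qed (use assms in simp)

text \<open>Every layer is a nondecreasing function of the value, so all increments have the sign of
  b - a and the absolute values telescope. Consequently the total influences of the layers of f add
  up to at most that of f.\<close>

lemma sum_layer_differences:
  fixes a b :: real
  assumes "mono c"
  shows "(\<Sum>l<J. \<bar>(min b (c (Suc l)) - min b (c l)) - (min a (c (Suc l)) - min a (c l))\<bar>) \<le> \<bar>b - a\<bar>"
proof -
  have *: "(\<Sum>l<J. \<bar>(min b (c (Suc l)) - min b (c l)) - (min a (c (Suc l)) - min a (c l))\<bar>) \<le> b - a"
    if "a \<le> b" for a b :: real
  proof -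
    have "c l \<le> c (Suc l)" for l using assms by (simp add: mono_def)
    then have "(\<Sum>l<J. \<bar>(min b (c (Suc l)) - min b (c l)) - (min a (c (Suc l)) - min a (c l))\<bar>)
      = (\<Sum>l<J. (min b (c (Suc l)) - min b (c l))) - (\<Sum>l<J. (min a (c (Suc l)) - min a (c l)))"
      unfolding sum_subtractf[symmetric] using that by (intro sum.cong refl) (smt (verit))
    also have "\<dots> = (min b (c J) - min b (c 0)) - (min a (c J) - min a (c 0))"
      using sum_lessThan_telescope[of "\<lambda>l. min b (c l)" J] sum_lessThan_telescope[of "\<lambda>l. min a (c l)" J] by simp
    also have "\<dots> \<le> b - a" using that assms[THEN monoD, of 0 J] by (simp add: min_def)
    finally show ?thesis .
  qed
  show ?thesis
  proof (cases "a \<le> b")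
    case False
    then show ?thesis using *[of b a] by (simp add: abs_minus_commute)
  qed (use *[of a b] in simp)
qed

section \<open>Conditional expectation given S, and approximation of a single layer\<close>

context slice_space
begin

definition condE :: "'a set \<Rightarrow> ('a set \<Rightarrow> real) \<Rightarrow> 'a set \<Rightarrow> real" where
  "condE S f X = kmean (N - S) (k - card (X \<inter> S)) (\<lambda>Y. f ((X \<inter> S) \<union> Y))"

text \<open>Invariance is required at all sets X, not only on the slice, so that it passes through
  sums and truncations pointwise; it makes the influences outside S vanish.\<close>

definition depends_on :: "'a set \<Rightarrow> ('a set \<Rightarrow> real) \<Rightarrow> bool" where
  "depends_on S g \<longleftrightarrow> (\<forall>i\<in>N - S. \<forall>j\<in>N - S. \<forall>X. g (sw i j X) = g X)"

lemma depends_on_condE: "depends_on S (condE S f)"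
proof -
  have "sw i j X \<inter> S = X \<inter> S" if "i \<notin> S" "j \<notin> S" for i j X
    using that by (auto simp: mem_sw Transposition.transpose_def split: if_splits)
  then show ?thesis by (simp add: depends_on_def condE_def)
qed

lemma fiber_mem:
  assumes "S \<subseteq> N" "X \<in> \<Omega>" "Y \<in> ksub (N - S) (k - card (X \<inter> S))"
  shows "(X \<inter> S) \<union> Y \<in> \<Omega>"
proof -
  have fX: "finite X" "finite Y" using assms fin by (auto simp: ksub_def dest: finite_subset)
  have "card ((X \<inter> S) \<union> Y) = card (X \<inter> S) + card Y"
    using assms fX by (intro card_Un_disjoint) (auto simp: ksub_def)
  moreover have "card (X \<inter> S) \<le> k"
    using assms fX card_mono[of X "X \<inter> S"] by (auto simp: ksub_def)
  ultimately show ?thesis using assms by (auto simp: ksub_def)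
qed

lemma condE_nonneg:
  assumes "S \<subseteq> N" "X \<in> \<Omega>" "\<And>X. X \<in> \<Omega> \<Longrightarrow> 0 \<le> f X"
  shows "0 \<le> condE S f X"
  unfolding condE_def kmean_def
  by (intro divide_nonneg_nonneg sum_nonneg assms(3) fiber_mem assms) auto

lemma condE_fiber:
  assumes "Z \<subseteq> S" "Y \<in> ksub (N - S) (k - card Z)"
  shows "condE S f (Z \<union> Y) = kmean (N - S) (k - card Z) (\<lambda>Y. f (Z \<union> Y))"
proof -
  have "(Z \<union> Y) \<inter> S = Z" using assms by (auto simp: ksub_def)
  then show ?thesis by (simp add: condE_def)
qed

lemma E_condE:
  assumes "S \<subseteq> N"
  shows "E (condE S f) = E f"
proof -
  have "(\<Sum>Y\<in>ksub (N - S) (k - card Z). condE S f (Z \<union> Y)) = (\<Sum>Y\<in>ksub (N - S) (k - card Z). f (Z \<union> Y))"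
    if "Z \<subseteq> S" for Z
  proof -
    have "(\<Sum>Y\<in>ksub (N - S) (k - card Z). condE S f (Z \<union> Y))
      = real (card (ksub (N - S) (k - card Z))) * kmean (N - S) (k - card Z) (\<lambda>Y. f (Z \<union> Y))"
      using condE_fiber[OF that] by simp
    also have "\<dots> = (\<Sum>Y\<in>ksub (N - S) (k - card Z). f (Z \<union> Y))"
      using fin by (cases "ksub (N - S) (k - card Z) = {}") (auto simp: kmean_def)
    finally show ?thesis .
  qed
  then show ?thesis
    unfolding E_alt sum_ksub_fibers[OF fin assms] by simp
qed

text \<open>Each fibre with prescribed trace on S is a slice over N - S, and transpositions outside
  S preserve it, so \<open>poincare\<close> applies fibre by fibre. The constant involves
  \<open>card (N - S)\<close> in place of n, which is why S may later occupy at most half of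
  N.\<close>

lemma condE_variance:
  assumes S: "S \<subseteq> N"
  shows "E (\<lambda>X. (f X - condE S f X)\<^sup>2)
    \<le> (\<Sum>i\<in>N - S. \<Sum>j\<in>N - S. E (\<lambda>X. (D i j f X)\<^sup>2)) / (2 * real (card (N - S)))"
proof -
  define M where "M = N - S"
  have fM: "finite M" using fin by (simp add: M_def)
  let ?Zs = "{Z. Z \<subseteq> S \<and> card Z \<le> k}"
  have fib: "(\<Sum>Y\<in>ksub M (k - card Z). (f (Z \<union> Y) - condE S f (Z \<union> Y))\<^sup>2)
    \<le> (\<Sum>Y\<in>ksub M (k - card Z). \<Sum>i\<in>M. \<Sum>j\<in>M. (D i j f (Z \<union> Y))\<^sup>2) / (2 * real (card M))"
    if Z: "Z \<subseteq> S" for Z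
  proof -
    have "(\<Sum>Y\<in>ksub M (k - card Z). (f (Z \<union> Y) - condE S f (Z \<union> Y))\<^sup>2)
      = sq_dev M (k - card Z) (\<lambda>Y. f (Z \<union> Y))"
      unfolding sq_dev_def M_def using condE_fiber[OF Z] by simp
    also have "\<dots> \<le> (\<Sum>Y\<in>ksub M (k - card Z). \<Sum>i\<in>M. \<Sum>j\<in>M. (f (Z \<union> Y) - f (Z \<union> sw i j Y))\<^sup>2) / (2 * real (card M))"
    proof (cases "k - card Z")
      case 0
      have "0 \<le> (\<Sum>Y\<in>ksub M (k - card Z). \<Sum>i\<in>M. \<Sum>j\<in>M. (f (Z \<union> Y) - f (Z \<union> sw i j Y))\<^sup>2) / (2 * real (card M))"
        by (intro divide_nonneg_nonneg sum_nonneg) auto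
      moreover have "sq_dev M (k - card Z) (\<lambda>Y. f (Z \<union> Y)) \<le> 0"
        using dev_trivial(2)[OF fM] 0 by blast
      ultimately show ?thesis by (rule order_trans[rotated])
    next
      case (Suc r)
      show ?thesis
        using poincare[OF fM, of r "\<lambda>Y. f (Z \<union> Y)"]
          sum_swaps_eq_edge_sum[where \<psi> = "\<lambda>u v. (u - v)\<^sup>2" and r = r and f = "\<lambda>Y. f (Z \<union> Y)", OF fM]
        by (simp add: Suc)
    qed
    also have "\<dots> = (\<Sum>Y\<in>ksub M (k - card Z). \<Sum>i\<in>M. \<Sum>j\<in>M. (D i j f (Z \<union> Y))\<^sup>2) / (2 * real (card M))"
    proof (intro arg_cong2[where f = "(/)"] sum.cong refl)
      fix Y i j assume ij: "i \<in> M" "j \<in> M"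
      have "sw i j Z = Z" using ij Z by (intro sw_id) (auto simp: M_def)
      then have "sw i j (Z \<union> Y) = Z \<union> sw i j Y" by (simp add: sw_def image_Un)
      then show "(f (Z \<union> Y) - f (Z \<union> sw i j Y))\<^sup>2 = (D i j f (Z \<union> Y))\<^sup>2"
        by (simp add: D_def power2_commute)
    qed
    finally show ?thesis .
  qed
  have "(\<Sum>X\<in>\<Omega>. (f X - condE S f X)\<^sup>2)
      = (\<Sum>Z\<in>?Zs. \<Sum>Y\<in>ksub M (k - card Z). (f (Z \<union> Y) - condE S f (Z \<union> Y))\<^sup>2)"
    unfolding M_def by (rule sum_ksub_fibers[OF fin S])
  also have "\<dots> \<le> (\<Sum>Z\<in>?Zs. (\<Sum>Y\<in>ksub M (k - card Z). \<Sum>i\<in>M. \<Sum>j\<in>M. (D i j f (Z \<union> Y))\<^sup>2) / (2 * real (card M)))"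
    by (intro sum_mono fib) auto
  also have "\<dots> = (\<Sum>X\<in>\<Omega>. \<Sum>i\<in>M. \<Sum>j\<in>M. (D i j f X)\<^sup>2) / (2 * real (card M))"
    unfolding M_def sum_ksub_fibers[OF fin S] by (simp flip: sum_divide_distrib)
  finally have "(\<Sum>X\<in>\<Omega>. (f X - condE S f X)\<^sup>2) / real (card \<Omega>)
      \<le> (\<Sum>X\<in>\<Omega>. \<Sum>i\<in>M. \<Sum>j\<in>M. (D i j f X)\<^sup>2) / (2 * real (card M)) / real (card \<Omega>)"
    by (rule divide_right_mono) simp
  also have "\<dots> = E (\<lambda>X. \<Sum>i\<in>M. \<Sum>j\<in>M. (D i j f X)\<^sup>2) / (2 * real (card M))"
    by (simp add: E_alt)
  finally show ?thesis by (simp add: E_alt[symmetric] E_sum M_def)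
qed

text \<open>The three errors come from smoothing, from rounding, and from the variance of the
  smoothed layer given S. What matters is that the rounding error is proportional to L times the
  measure of A: summed over dyadic layers this stays comparable to 1 + E f, whatever the number of
  layers.\<close>

lemma layer_approx:
  assumes S: "S \<subseteq> N" "n \<le> 2 * real (card (N - S))"
    and L: "L > 0" and F: "\<And>X. X \<in> \<Omega> \<Longrightarrow> 0 \<le> F X" "\<And>X. X \<in> \<Omega> \<Longrightarrow> F X \<le> L * of_bool (A X)"
    and small: "\<And>i j. i \<in> N - S \<Longrightarrow> j \<in> N - S \<Longrightarrow> infl i j F \<le> L * \<rho>"
    and e: "0 < e" "e \<le> 1"
  shows "\<exists>H. depends_on S H \<and> E (\<lambda>X. \<bar>F X - H X\<bar>)
    \<le> real m / n * tot F + 2 * e * L * E (\<lambda>X. of_bool (A X)) + \<rho> powr (1 - (1 - rate) ^ m) / e\<^sup>2 * tot F"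
proof -
  define \<beta> where "\<beta> = 1 - (1 - rate) ^ m"
  define P where "P = (T ^^ m) F"
  define G where "G = condE S P"
  define H where "H X = (if G X > e * L then G X else 0)" for X
  define a where "a = E (\<lambda>X. of_bool (A X) :: real)"
  have F1: "F X \<le> L" "\<not> A X \<Longrightarrow> F X = 0" if "X \<in> \<Omega>" for X
    using F[OF that] L by (auto simp: of_bool_def split: if_splits)
  have dep: "depends_on S H"
    using depends_on_condE[of S P] by (simp add: depends_on_def H_def G_def)
  have P0: "0 \<le> P X" if "X \<in> \<Omega>" for X
  proof -
    have "\<forall>X\<in>\<Omega>. 0 \<le> (T ^^ m) F X"
    proof (induction m)
      case (Suc m)
      then show ?case
        by (auto simp: T_def intro!: divide_nonneg_nonneg sum_nonneg add_nonneg_nonneg sw_ksub)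
    qed (use F in simp)
    then show ?thesis using that by (simp add: P_def)
  qed
  have G0: "0 \<le> G X" if "X \<in> \<Omega>" for X
    unfolding G_def by (rule condE_nonneg[OF S(1) that P0])
  have EP: "E P = E F"
  proof -
    have "E ((T ^^ m) F) = E F" by (induction m) (simp_all add: E_T)
    then show ?thesis by (simp add: P_def)
  qed
  have "E F \<le> E (\<lambda>X. L * of_bool (A X))" by (intro E_mono F)
  then have EG: "E G \<le> L * a" by (simp add: G_def E_condE[OF S(1)] EP E_cmult a_def)
  \<comment> \<open>A difference of F is bounded by L and has L1 norm at most
    \<open>L * \<rho>\<close>, so its smoothing gains a power of \<rho> while its influence remains
    as a factor.\<close>
  have DP: "E (\<lambda>X. (D i j P X)\<^sup>2) \<le> L * \<rho> powr \<beta> * infl i j F" if "i \<in> N - S" "j \<in> N - S" for i j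
  proof -
    have "E (\<lambda>X. ((T ^^ m) (D i j F) X)\<^sup>2) \<le> L * E (\<lambda>X. \<bar>D i j F X\<bar>) * \<rho> powr (1 - (1 - rate) ^ m)"
    proof (rule T_iter_small[OF L])
      fix X assume X: "X \<in> \<Omega>"
      then have "sw i j X \<in> \<Omega>" using that by (intro sw_ksub) auto
      then show "\<bar>D i j F X\<bar> \<le> L"
        using F(1)[OF X] F1(1)[OF X] F(1)[of "sw i j X"] F1(1)[of "sw i j X"] by (auto simp: D_def)
    qed (use small[OF that] in \<open>simp add: infl_def\<close>)
    then show ?thesis
      using that by (simp add: P_def \<beta>_def infl_def T_iter_D mult_ac)
  qed
  have PG: "E (\<lambda>X. (P X - G X)\<^sup>2) \<le> 2 * L * \<rho> powr \<beta> * tot F"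
  proof -
    have M0: "real (card (N - S)) > 0" using S(2) n_pos by simp
    have "(\<Sum>i\<in>N - S. \<Sum>j\<in>N - S. E (\<lambda>X. (D i j P X)\<^sup>2))
        \<le> (\<Sum>i\<in>N - S. \<Sum>j\<in>N - S. L * \<rho> powr \<beta> * infl i j F)"
      by (intro sum_mono DP)
    also have "\<dots> = L * \<rho> powr \<beta> * (\<Sum>i\<in>N - S. \<Sum>j\<in>N - S. infl i j F)"
      by (simp add: sum_distrib_left)
    also have "(\<Sum>i\<in>N - S. \<Sum>j\<in>N - S. infl i j F) \<le> (\<Sum>i\<in>N. \<Sum>j\<in>N. infl i j F)"
      using fin infl_nonneg
      by (intro order_trans[OF sum_mono[OF sum_mono2] sum_mono2] sum_nonneg) auto
    also have "(\<Sum>i\<in>N. \<Sum>j\<in>N. infl i j F) = 2 * n * tot F"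
      using n_pos by (simp add: tot_def)
    finally have "(\<Sum>i\<in>N - S. \<Sum>j\<in>N - S. E (\<lambda>X. (D i j P X)\<^sup>2)) \<le> L * \<rho> powr \<beta> * (2 * n * tot F)"
      using L by (simp add: mult_left_mono)
    also have "\<dots> \<le> L * \<rho> powr \<beta> * (2 * (2 * real (card (N - S))) * tot F)"
      using L S(2) tot_nonneg by (intro mult_left_mono mult_right_mono) auto
    also have "\<dots> = (2 * L * \<rho> powr \<beta> * tot F) * (2 * real (card (N - S)))" by simp
    finally have "(\<Sum>i\<in>N - S. \<Sum>j\<in>N - S. E (\<lambda>X. (D i j P X)\<^sup>2)) / (2 * real (card (N - S)))
        \<le> 2 * L * \<rho> powr \<beta> * tot F"
      using M0 by (simp add: divide_le_eq)
    then show ?thesis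
      unfolding G_def using condE_variance[OF S(1), of P] by linarith
  qed
  \<comment> \<open>F - H vanishes unless \<open>A X\<close> or \<open>G X > e * L\<close>; there |P - G| is estimated by AM-GM,
    and Markov's inequality for G enters through the term \<open>e / 2 * G X\<close>.\<close>
  have pt: "\<bar>F X - H X\<bar> \<le> \<bar>F X - P X\<bar> + (e\<^sup>2 * L / 2 + e * L) * of_bool (A X) + e / 2 * G X
      + 1 / (2 * e\<^sup>2 * L) * (P X - G X)\<^sup>2" if X: "X \<in> \<Omega>" for X
  proof -
    \<comment> \<open>The AM-GM parameter is tuned to the rounding threshold: where G exceeds
      \<open>e * L\<close>, the cost \<kappa>/2 is at most \<open>e / 2 * G X\<close>, whose mean is
      controlled by \<open>E G \<le> L * a\<close>.\<close>
    define \<kappa> where "\<kappa> = e\<^sup>2 * L"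
    have k0: "\<kappa> > 0" using e L by (simp add: \<kappa>_def)
    have amgm: "\<bar>P X - G X\<bar> \<le> \<kappa> / 2 + 1 / (2 * \<kappa>) * (P X - G X)\<^sup>2"
    proof -
      have "0 \<le> (\<bar>P X - G X\<bar> - \<kappa>)\<^sup>2 / (2 * \<kappa>)" using k0 by simp
      also have "\<dots> = \<kappa> / 2 + 1 / (2 * \<kappa>) * (P X - G X)\<^sup>2 - \<bar>P X - G X\<bar>"
        using k0 by (simp add: power2_diff field_simps) (simp add: power2_eq_square)
      finally show ?thesis by simp
    qed
    have q0: "0 \<le> 1 / (2 * \<kappa>) * (P X - G X)\<^sup>2" using k0 by simp
    have g0: "0 \<le> e / 2 * G X" using e G0[OF X] by simp
    have split: "e\<^sup>2 * L / 2 = \<kappa> / 2" "1 / (2 * e\<^sup>2 * L) = 1 / (2 * \<kappa>)" by (simp_all add: \<kappa>_def mult_ac)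
    have "\<bar>F X - H X\<bar> \<le> \<bar>F X - P X\<bar> + (\<kappa> / 2 + e * L) * of_bool (A X) + e / 2 * G X
        + 1 / (2 * \<kappa>) * (P X - G X)\<^sup>2"
    proof (cases "A X")
      case True
      have "\<bar>F X - H X\<bar> \<le> \<bar>F X - P X\<bar> + \<bar>P X - G X\<bar> + e * L"
        using G0[OF X] mult_pos_pos[OF e(1) L] by (auto simp: H_def)
      then show ?thesis using amgm g0 True by simp
    next
      case False
      then have FX: "F X = 0" using F1(2)[OF X] by simp
      show ?thesis
      proof (cases "G X > e * L")
        case True
        have "\<kappa> / 2 \<le> e / 2 * G X"
          using mult_left_mono[of "e * L" "G X" "e / 2"] True e by (simp add: \<kappa>_def power2_eq_square mult_ac)
        then show ?thesis using amgm True FX False by (simp add: H_def)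
      next
        case False
        then show ?thesis using FX q0 g0 \<open>\<not> A X\<close> by (simp add: H_def)
      qed
    qed
    then show ?thesis by (simp only: split)
  qed
  have "E (\<lambda>X. \<bar>F X - H X\<bar>) \<le> E (\<lambda>X. \<bar>F X - P X\<bar> + (e\<^sup>2 * L / 2 + e * L) * of_bool (A X) + e / 2 * G X
      + 1 / (2 * e\<^sup>2 * L) * (P X - G X)\<^sup>2)"
    by (intro E_mono pt)
  also have "\<dots> = E (\<lambda>X. \<bar>F X - P X\<bar>) + (e\<^sup>2 * L / 2 + e * L) * a + e / 2 * E G
      + 1 / (2 * e\<^sup>2 * L) * E (\<lambda>X. (P X - G X)\<^sup>2)"
    by (simp only: E_add E_cmult a_def)
  also have "\<dots> \<le> real m * tot F / n + (e\<^sup>2 * L / 2 + e * L) * a + e / 2 * (L * a)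
      + 1 / (2 * e\<^sup>2 * L) * (2 * L * \<rho> powr \<beta> * tot F)"
    using T_iter_approx[of F m] EG PG e L
    by (intro add_mono mult_left_mono) (auto simp: P_def)
  also have "1 / (2 * e\<^sup>2 * L) * (2 * L * \<rho> powr \<beta> * tot F) = \<rho> powr \<beta> / e\<^sup>2 * tot F"
    using L by simp
  finally have bound: "E (\<lambda>X. \<bar>F X - H X\<bar>) \<le> real m * tot F / n + (e\<^sup>2 * L / 2 + e * L) * a
      + e / 2 * (L * a) + \<rho> powr \<beta> / e\<^sup>2 * tot F" .
  have "(e\<^sup>2 * L / 2 + e * L) * a + e / 2 * (L * a) \<le> 2 * e * L * a"
  proof -
    have "a \<ge> 0" unfolding a_def by (rule E_nonneg) simp
    then have "e\<^sup>2 * (L * a) \<le> e * (L * a)"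
      using e L by (intro mult_right_mono) (auto simp: power2_eq_square mult_left_le)
    then show ?thesis by (simp add: algebra_simps)
  qed
  with bound have "E (\<lambda>X. \<bar>F X - H X\<bar>) \<le> real m / n * tot F + 2 * e * L * a + \<rho> powr \<beta> / e\<^sup>2 * tot F"
    by simp
  then show ?thesis using dep by (auto simp: a_def \<beta>_def)
qed

end

section \<open>Assembling the layers and choosing the influential coordinates\<close>

context slice_space
begin

lemma depends_on_sum: "(\<And>l. l \<in> A \<Longrightarrow> depends_on S (h l)) \<Longrightarrow> depends_on S (\<lambda>X. \<Sum>l\<in>A. h l X)"
  unfolding depends_on_def by simp

lemma infl_mono:
  assumes "i \<in> N" "j \<in> N" "\<And>X Y. X \<in> \<Omega> \<Longrightarrow> Y \<in> \<Omega> \<Longrightarrow> \<bar>g X - g Y\<bar> \<le> \<bar>f X - f Y\<bar>"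
  shows "infl i j g \<le> infl i j f"
  unfolding infl_def D_def by (intro E_mono assms sw_ksub)

lemma tot_mono:
  assumes "\<And>X Y. X \<in> \<Omega> \<Longrightarrow> Y \<in> \<Omega> \<Longrightarrow> \<bar>g X - g Y\<bar> \<le> \<bar>f X - f Y\<bar>"
  shows "tot g \<le> tot f"
  unfolding tot_def using assms by (intro divide_right_mono sum_mono infl_mono) auto

lemma tot_sum_le:
  assumes "\<And>X Y. X \<in> \<Omega> \<Longrightarrow> Y \<in> \<Omega> \<Longrightarrow> (\<Sum>l\<in>A. \<bar>g l X - g l Y\<bar>) \<le> \<bar>f X - f Y\<bar>"
  shows "(\<Sum>l\<in>A. tot (g l)) \<le> tot f"
proof -
  have "(\<Sum>l\<in>A. tot (g l)) = (\<Sum>i\<in>N. \<Sum>j\<in>N. \<Sum>l\<in>A. infl i j (g l)) / (2 * n)"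
    unfolding tot_def sum_divide_distrib [symmetric] by (subst sum_swap3) (rule refl)
  also have "(\<Sum>i\<in>N. \<Sum>j\<in>N. \<Sum>l\<in>A. infl i j (g l)) \<le> (\<Sum>i\<in>N. \<Sum>j\<in>N. infl i j f)"
    unfolding infl_def E_sum[symmetric] D_def
    by (intro sum_mono E_mono assms sw_ksub)
  finally show ?thesis using n_pos by (simp add: tot_def divide_right_mono)
qed

text \<open>The levels \<open>2 ^ l - 1\<close> start at 0, and each layer \<open>l\<close> has height \<open>2 ^ l \<ge> 1\<close>.\<close>

lemma nonneg_approx:
  assumes S: "S \<subseteq> N" "n \<le> 2 * real (card (N - S))"
    and f: "\<And>X. X \<in> \<Omega> \<Longrightarrow> 0 \<le> f X"
    and small: "\<And>i j. i \<in> N - S \<Longrightarrow> j \<in> N - S \<Longrightarrow> infl i j f \<le> \<rho>"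
    and e: "0 < e" "e \<le> 1"
  shows "\<exists>H. depends_on S H \<and> E (\<lambda>X. \<bar>f X - H X\<bar>)
    \<le> (real m / n + \<rho> powr (1 - (1 - rate) ^ m) / e\<^sup>2) * tot f + 2 * e * (1 + 2 * E f)"
proof -
  define c where "c l = (2::real) ^ l - 1" for l :: nat
  have mono: "mono c" by (auto simp: mono_def c_def)
  have c_step: "c (Suc l) - c l = 2 ^ l" for l by (simp add: c_def)
  define F where "F l X = min (f X) (c (Suc l)) - min (f X) (c l)" for l X
  define A where "A l X \<longleftrightarrow> 2 ^ l - 1 < f X" for l X
  define b where "b = \<rho> powr (1 - (1 - rate) ^ m) / e\<^sup>2"
  \<comment> \<open>A function on a finite slice is bounded, so finitely many layers exhaust f;
    their number does not enter the final estimate.\<close>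
  obtain J :: nat where J: "\<And>X. X \<in> \<Omega> \<Longrightarrow> f X \<le> c J"
  proof -
    obtain J :: nat where "(\<Sum>X\<in>\<Omega>. f X) + 1 < 2 ^ J"
      using real_arch_pow[of 2] by auto
    moreover have "f X \<le> (\<Sum>X\<in>\<Omega>. f X)" if "X \<in> \<Omega>" for X
      using that f fin by (intro member_le_sum) auto
    ultimately have "f X \<le> c J" if "X \<in> \<Omega>" for X
      using that by (fastforce simp: c_def)
    then show thesis by (rule that)
  qed
  have diffs: "(\<Sum>l<J. \<bar>F l X - F l Y\<bar>) \<le> \<bar>f X - f Y\<bar>" for J X Y
    unfolding F_def by (rule sum_layer_differences[OF mono])
  have diff: "\<bar>F l X - F l Y\<bar> \<le> \<bar>f X - f Y\<bar>" for l X Y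
  proof -
    have "0 \<le> (\<Sum>l'<l. \<bar>F l' X - F l' Y\<bar>)" by (intro sum_nonneg) simp
    then show ?thesis
      using diffs[where J = "Suc l" and X = X and Y = Y] unfolding sum.lessThan_Suc by linarith
  qed
  have "\<exists>H. depends_on S H \<and> E (\<lambda>X. \<bar>F l X - H X\<bar>)
      \<le> real m / n * tot (F l) + 2 * e * 2 ^ l * E (\<lambda>X. of_bool (A l X)) + b * tot (F l)" for l
    unfolding b_def
  proof (rule layer_approx[OF S])
    fix X assume X: "X \<in> \<Omega>"
    show "0 \<le> F l X" using monoD[OF mono, of l "Suc l"] by (auto simp: F_def min_def)
    show "F l X \<le> 2 ^ l * of_bool (A l X)"
      using c_step[of l] by (auto simp: F_def A_def c_def)
  next
    fix i j assume ij: "i \<in> N - S" "j \<in> N - S"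
    have "infl i j (F l) \<le> infl i j f" using ij diff by (intro infl_mono) auto
    also have "\<dots> \<le> \<rho>" by (rule small[OF ij])
    also have "\<dots> \<le> 2 ^ l * \<rho>"
      using order_trans[OF infl_nonneg small[OF ij]] by (simp add: mult_le_cancel_right1)
    finally show "infl i j (F l) \<le> 2 ^ l * \<rho>" .
  qed (use e in auto)
  then obtain H where dep: "\<And>l. depends_on S (H l)"
    and H: "\<And>l. E (\<lambda>X. \<bar>F l X - H l X\<bar>)
      \<le> real m / n * tot (F l) + 2 * e * 2 ^ l * E (\<lambda>X. of_bool (A l X)) + b * tot (F l)"
    by metis
  have b0: "0 \<le> b" by (simp add: b_def)
  have "\<bar>f X - (\<Sum>l<J. H l X)\<bar> \<le> (\<Sum>l<J. \<bar>F l X - H l X\<bar>)" if X: "X \<in> \<Omega>" for X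
  proof -
    have "(\<Sum>l<J. F l X) = min (f X) (c J) - min (f X) (c 0)"
      unfolding F_def by (rule sum_lessThan_telescope)
    also have "\<dots> = f X" using J[OF X] f[OF X] by (simp add: c_def)
    finally have "f X - (\<Sum>l<J. H l X) = (\<Sum>l<J. F l X - H l X)" by (simp add: sum_subtractf)
    then show ?thesis by simp
  qed
  then have "E (\<lambda>X. \<bar>f X - (\<Sum>l<J. H l X)\<bar>) \<le> E (\<lambda>X. \<Sum>l<J. \<bar>F l X - H l X\<bar>)"
    by (rule E_mono)
  also have "\<dots> \<le> (\<Sum>l<J. real m / n * tot (F l) + 2 * e * 2 ^ l * E (\<lambda>X. of_bool (A l X)) + b * tot (F l))"
    unfolding E_sum by (intro sum_mono H)
  also have "\<dots> = (real m / n + b) * (\<Sum>l<J. tot (F l)) + 2 * e * E (\<lambda>X. \<Sum>l<J. 2 ^ l * of_bool (A l X))"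
  proof -
    have "(\<Sum>l<J. real m / n * tot (F l) + 2 * e * 2 ^ l * E (\<lambda>X. of_bool (A l X)) + b * tot (F l))
        = (\<Sum>l<J. (real m / n + b) * tot (F l) + 2 * e * (2 ^ l * E (\<lambda>X. of_bool (A l X))))"
      by (intro sum.cong refl) (simp add: algebra_simps)
    then show ?thesis by (simp only: sum.distrib sum_distrib_left E_sum E_cmult)
  qed
  also have "\<dots> \<le> (real m / n + b) * tot f + 2 * e * E (\<lambda>X. 1 + 2 * f X)"
    using b0 e f unfolding A_def
    by (intro add_mono mult_left_mono E_mono sum_layer_heights tot_sum_le diffs) auto
  also have "E (\<lambda>X. 1 + 2 * f X) = 1 + 2 * E f" by (simp only: E_add E_cmult E_const)
  finally have "E (\<lambda>X. \<bar>f X - (\<Sum>l<J. H l X)\<bar>) \<le> (real m / n + b) * tot f + 2 * e * (1 + 2 * E f)" .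
  moreover have "depends_on S (\<lambda>X. \<Sum>l<J. H l X)" by (rule depends_on_sum[OF dep])
  ultimately show ?thesis unfolding b_def by blast
qed

text \<open>Total influence ignores constants, so no bound on the mean of |f| is available. Centring
  f first makes the L1 Poincare inequality bound the mean of either part by 2K. Both parts share the
  same S, so their approximants can be combined.\<close>

lemma signed_approx:
  assumes S: "S \<subseteq> N" "n \<le> 2 * real (card (N - S))"
    and small: "\<And>i j. i \<in> N - S \<Longrightarrow> j \<in> N - S \<Longrightarrow> infl i j f \<le> \<rho>"
    and e: "0 < e" "e \<le> 1" and K: "tot f \<le> K"
  shows "\<exists>H. depends_on S H \<and> E (\<lambda>X. \<bar>f X - H X\<bar>)
    \<le> 2 * ((real m / n + \<rho> powr (1 - (1 - rate) ^ m) / e\<^sup>2) * K + 2 * e * (1 + 4 * K))"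
proof -
  define R where "R = real m / n + \<rho> powr (1 - (1 - rate) ^ m) / e\<^sup>2"
  have R0: "R \<ge> 0" by (simp add: R_def)
  have one: "\<exists>H. depends_on S H \<and> E (\<lambda>X. \<bar>g X - H X\<bar>) \<le> R * K + 2 * e * (1 + 4 * K)"
    if g: "\<And>X. 0 \<le> g X" "\<And>X. g X \<le> \<bar>f X - E f\<bar>" "\<And>X Y. \<bar>g X - g Y\<bar> \<le> \<bar>f X - f Y\<bar>" for g
  proof -
    have "\<exists>H. depends_on S H \<and> E (\<lambda>X. \<bar>g X - H X\<bar>) \<le> R * tot g + 2 * e * (1 + 2 * E g)"
      unfolding R_def
    proof (rule nonneg_approx[OF S _ _ e])
      show "infl i j g \<le> \<rho>" if "i \<in> N - S" "j \<in> N - S" for i j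
        using infl_mono[of i j g f] g(3) small[OF that] that by fastforce
    qed (rule g(1))
    moreover have "tot g \<le> K" using tot_mono[of g f] g(3) K by simp
    moreover have "E g \<le> 2 * K"
      using E_mono[of g "\<lambda>X. \<bar>f X - E f\<bar>"] g(2) mean_deviation_le_tot[of f] K by simp
    ultimately have "\<exists>H. depends_on S H \<and> E (\<lambda>X. \<bar>g X - H X\<bar>) \<le> R * tot g + 2 * e * (1 + 2 * E g)"
      and "R * tot g + 2 * e * (1 + 2 * E g) \<le> R * K + 2 * e * (1 + 4 * K)"
      using R0 e by (auto intro!: add_mono mult_left_mono)
    then show ?thesis by (meson order_trans)
  qed
  obtain H1 where H1: "depends_on S H1"
    "E (\<lambda>X. \<bar>max (f X - E f) 0 - H1 X\<bar>) \<le> R * K + 2 * e * (1 + 4 * K)"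
    using one[of "\<lambda>X. max (f X - E f) 0"] by fastforce
  obtain H2 where H2: "depends_on S H2"
    "E (\<lambda>X. \<bar>max (E f - f X) 0 - H2 X\<bar>) \<le> R * K + 2 * e * (1 + 4 * K)"
    using one[of "\<lambda>X. max (E f - f X) 0"] by fastforce
  define H where "H X = E f + H1 X - H2 X" for X
  have "E (\<lambda>X. \<bar>f X - H X\<bar>)
      \<le> E (\<lambda>X. \<bar>max (f X - E f) 0 - H1 X\<bar> + \<bar>max (E f - f X) 0 - H2 X\<bar>)"
    by (rule E_mono) (auto simp: H_def max_def)
  also have "\<dots> \<le> 2 * (R * K + 2 * e * (1 + 4 * K))"
    unfolding E_add using H1(2) H2(2) by simp
  finally have "E (\<lambda>X. \<bar>f X - H X\<bar>) \<le> 2 * (R * K + 2 * e * (1 + 4 * K))" .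
  moreover have "depends_on S H"
    using H1(1) H2(1) by (simp add: depends_on_def H_def)
  ultimately show ?thesis unfolding R_def by blast
qed

lemma infl_commute: "infl i j f = infl j i f"
  by (simp add: infl_def D_def sw_commute[of i j])

text \<open>For distinct i, j, l, the transposition (i j) is (i l)(l j)(i l), and switching
  coordinates preserves the uniform measure.\<close>

lemma infl_triangle:
  assumes "i \<in> N" "j \<in> N" "l \<in> N"
  shows "infl i j f \<le> 2 * infl i l f + infl l j f"
proof -
  consider "i = j" | "l = i" | "l = j" | "i \<noteq> j" "l \<noteq> i" "l \<noteq> j" by blast
  then show ?thesis
  proof cases
    case 1
    then have "infl i j f = 0" by (simp add: infl_def D_def)
    then show ?thesis using infl_nonneg[of i l f] infl_nonneg[of l j f] by simp
  next
    case 4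
    have "sw i j X = sw i l (sw l j (sw i l X))" for X
      using 4 by (auto simp: set_eq_iff mem_sw Transposition.transpose_def)
    then have "\<bar>D i j f X\<bar> \<le> \<bar>D i l f (sw l j (sw i l X))\<bar> + \<bar>D l j f (sw i l X)\<bar> + \<bar>D i l f X\<bar>" for X
      by (simp add: D_def)
    then have "infl i j f \<le> E (\<lambda>X. \<bar>D i l f (sw l j (sw i l X))\<bar> + \<bar>D l j f (sw i l X)\<bar> + \<bar>D i l f X\<bar>)"
      unfolding infl_def by (intro E_mono)
    also have "\<dots> = 2 * infl i l f + infl l j f"
      using E_sw[of i l "\<lambda>X. \<bar>D i l f (sw l j X)\<bar>"] E_sw[of l j "\<lambda>X. \<bar>D i l f X\<bar>"]
        E_sw[of i l "\<lambda>X. \<bar>D l j f X\<bar>"] assms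
      by (simp add: E_add infl_def)
    finally show ?thesis .
  qed (use infl_nonneg[of i l f] infl_nonneg[of l j f] in auto)
qed

theorem junta_approx:
  assumes \<rho>: "\<rho> > 0" "12 * K / \<rho> \<le> n"
    and e: "0 < e" "e \<le> 1" and K: "tot f \<le> K"
  shows "\<exists>S H. S \<subseteq> N \<and> real (card S) \<le> 6 * K / \<rho> \<and> depends_on S H \<and> E (\<lambda>X. \<bar>f X - H X\<bar>)
    \<le> 2 * ((real m / n + \<rho> powr (1 - (1 - rate) ^ m) / e\<^sup>2) * K + 2 * e * (1 + 4 * K))"
proof -
  \<comment> \<open>S collects the indices with large average influence against all others. Markov's
    inequality bounds its size; for i, j outside S, averaging \<open>infl_triangle\<close> over l
    yields at most 2\<rho>/3 + \<rho>/3 = \<rho>.\<close>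
  define S where "S = {i \<in> N. \<rho> / 3 * n < (\<Sum>l\<in>N. infl i l f)}"
  have SN: "S \<subseteq> N" by (auto simp: S_def)
  have "real (card S) * (\<rho> / 3 * n) = (\<Sum>i\<in>S. \<rho> / 3 * n)" by simp
  also have "\<dots> \<le> (\<Sum>i\<in>S. \<Sum>l\<in>N. infl i l f)"
    by (intro sum_mono) (auto simp: S_def)
  also have "\<dots> \<le> (\<Sum>i\<in>N. \<Sum>l\<in>N. infl i l f)"
    using fin SN infl_nonneg by (intro sum_mono2 sum_nonneg) auto
  also have "\<dots> = 2 * n * tot f" using n_pos by (simp add: tot_def)
  also have "\<dots> \<le> 2 * n * K" using K n_pos by (intro mult_left_mono) auto
  finally have "real (card S) * (\<rho> / 3) * n \<le> (2 * K) * n" by (simp add: mult_ac)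
  then have "real (card S) * (\<rho> / 3) \<le> 2 * K" using n_pos by simp
  then have card: "real (card S) \<le> 6 * K / \<rho>" using \<rho>(1) by (simp add: field_simps)
  have "real (card (N - S)) = n - real (card S)"
    using SN fin by (simp add: card_Diff_subset finite_subset card_mono of_nat_diff)
  then have half: "n \<le> 2 * real (card (N - S))" using card \<rho>(2) by simp
  have "infl i j f \<le> \<rho>" if ij: "i \<in> N - S" "j \<in> N - S" for i j
  proof -
    have "n * infl i j f = (\<Sum>l\<in>N. infl i j f)" by simp
    also have "\<dots> \<le> (\<Sum>l\<in>N. 2 * infl i l f + infl l j f)"
      using ij by (intro sum_mono infl_triangle) auto
    also have "\<dots> = 2 * (\<Sum>l\<in>N. infl i l f) + (\<Sum>l\<in>N. infl j l f)"
      by (simp add: sum.distrib sum_distrib_left infl_commute[of j])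
    also have "\<dots> \<le> 2 * (\<rho> / 3 * n) + \<rho> / 3 * n"
      using ij by (intro add_mono mult_left_mono) (auto simp: S_def not_less)
    also have "\<dots> = n * \<rho>" by simp
    finally show ?thesis using n_pos by simp
  qed
  then show ?thesis
    using signed_approx[OF SN half _ e K, of \<rho> m] card SN by blast
qed

end

section \<open>Transfer to the slice of the cube\<close>

lemma sum_symmetric_pairs:
  fixes g :: "nat \<Rightarrow> nat \<Rightarrow> real"
  assumes "\<And>i j. g i j = g j i" "\<And>i. g i i = 0"
  shows "(\<Sum>i\<in>{1..n}. \<Sum>j\<in>{1..n}. g i j) = 2 * (\<Sum>j = 1..n. \<Sum>i = 1..<j. g i j)"
proof (induction n)
  case (Suc n)
  have "(\<Sum>i\<in>{1..Suc n}. \<Sum>j\<in>{1..Suc n}. g i j)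
      = (\<Sum>i\<in>{1..n}. \<Sum>j\<in>{1..n}. g i j) + (\<Sum>i\<in>{1..n}. g i (Suc n)) + (\<Sum>j\<in>{1..n}. g (Suc n) j)"
    using assms(2) by (simp add: sum.distrib)
  also have "(\<Sum>j\<in>{1..n}. g (Suc n) j) = (\<Sum>i\<in>{1..n}. g i (Suc n))"
    using assms(1) by simp
  finally show ?case
    using Suc by (simp add: atLeastLessThanSuc_atLeastAtMost)
qed simp

definition point_of :: "nat \<Rightarrow> nat set \<Rightarrow> nat \<Rightarrow> nat" where
  "point_of n X = restrict (\<lambda>i. of_bool (i \<in> X)) {1..n}"

lemma bij_point_of: "bij_betw (point_of n) (ksub {1..n} k) (slice n k)"
proof (rule bij_betwI[where g = "\<lambda>x. {i \<in> {1..n}. x i = 1}"])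
  have "(\<Sum>i = 1..n. point_of n X i) = card X" if "X \<subseteq> {1..n}" for X
  proof -
    have "(\<Sum>i = 1..n. point_of n X i) = (\<Sum>i = 1..n. of_bool (i \<in> X))"
      by (intro sum.cong) (auto simp: point_of_def)
    also have "\<dots> = card X"
      using that by (simp add: Int_absorb1)
    finally show ?thesis .
  qed
  then show "point_of n \<in> ksub {1..n} k \<rightarrow> slice n k"
    by (auto simp: ksub_def slice_def point_of_def)
  show "(\<lambda>x. {i \<in> {1..n}. x i = 1}) \<in> slice n k \<rightarrow> ksub {1..n} k"
  proof
    fix x assume x: "x \<in> slice n k"
    then have "x i \<in> {0, 1}" if "i \<in> {1..n}" for i
      using that by (auto simp: slice_def PiE_iff)
    then have "(\<Sum>i = 1..n. x i) = (\<Sum>i = 1..n. of_bool (x i = 1))"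
      by (intro sum.cong) auto
    also have "\<dots> = card {i \<in> {1..n}. x i = 1}"
      by (simp add: Int_def)
    finally show "{i \<in> {1..n}. x i = 1} \<in> ksub {1..n} k"
      using x by (auto simp: slice_def ksub_def)
  qed
  show "{i \<in> {1..n}. point_of n X i = 1} = X" if "X \<in> ksub {1..n} k" for X
    using that by (auto simp: point_of_def ksub_def)
  show "point_of n {i \<in> {1..n}. x i = 1} = x" if "x \<in> slice n k" for x
  proof
    fix i
    show "point_of n {i \<in> {1..n}. x i = 1} i = x i"
    proof (cases "i \<in> {1..n}")
      case True
      then have "x i \<in> {0, 1}" using that by (auto simp: slice_def PiE_iff)
      then show ?thesis using True by (auto simp: point_of_def)
    next
      case False
      then show ?thesis using that by (auto simp: slice_def point_of_def PiE_iff extensional_def)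
    qed
  qed
qed

lemma switch_point_of:
  assumes "i \<in> {1..n}" "j \<in> {1..n}"
  shows "switch i j (point_of n X) = point_of n (sw i j X)"
proof
  fix l
  have "Transposition.transpose i j l \<in> {1..n} \<longleftrightarrow> l \<in> {1..n}"
    using assms by (auto simp: Transposition.transpose_def)
  then show "switch i j (point_of n X) l = point_of n (sw i j X) l"
    by (simp add: switch_def point_of_def mem_sw)
qed

lemma L1_norm_eq: "L1_norm n k f = kmean {1..n} k (\<lambda>X. \<bar>f (point_of n X)\<bar>)"
proof -
  have "L1_norm n k f = (\<Sum>x\<in>slice n k. \<bar>f x\<bar>) / real (card (slice n k))"
    unfolding L1_norm_def slice_measure_def
    by (rule integral_uniform_count_measure[OF finite_slice])
  also have "(\<Sum>x\<in>slice n k. \<bar>f x\<bar>) = (\<Sum>X\<in>ksub {1..n} k. \<bar>f (point_of n X)\<bar>)"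
    by (rule sum.reindex_bij_betw[OF bij_point_of, symmetric])
  also have "card (slice n k) = card (ksub {1..n} k)"
    by (rule bij_betw_same_card[OF bij_point_of, symmetric])
  finally show ?thesis by (simp add: kmean_def)
qed

lemma influence_eq:
  assumes "i \<in> {1..n}" "j \<in> {1..n}" "0 < k" "k < n"
  shows "influence n k i j f = slice_space.infl {1..n} k i j (\<lambda>X. f (point_of n X))"
proof -
  interpret slice_space "{1..n}" k using assms by unfold_locales auto
  note [simp del] = One_nat_def
  show ?thesis
    by (simp add: influence_def L1_norm_eq infl_def E_def D_switch_def D_def switch_point_of[OF assms(1,2)]
       )
qed

lemma total_influence_eq:
  assumes "0 < k" "k < n"
  shows "total_influence n k f = slice_space.tot {1..n} k (\<lambda>X. f (point_of n X))"
proof -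
  interpret slice_space "{1..n}" k using assms by unfold_locales auto
  note [simp del] = One_nat_def
  let ?h = "\<lambda>X. f (point_of n X)"
  have "(\<Sum>j = 1..n. \<Sum>i = 1..<j. influence n k i j f) = (\<Sum>j = 1..n. \<Sum>i = 1..<j. infl i j ?h)"
    by (intro sum.cong refl influence_eq) (use assms in auto)
  also have "\<dots> = (\<Sum>i\<in>{1..n}. \<Sum>j\<in>{1..n}. infl i j ?h) / 2"
  proof -
    have "infl i i ?h = 0" for i by (simp add: infl_def D_def)
    then show ?thesis using sum_symmetric_pairs[of "\<lambda>i j. infl i j ?h" n] infl_commute[of _ _ ?h]
      by (simp)
  qed
  finally show ?thesis using assms by (simp add: total_influence_def tot_def field_simps)
qed

text \<open>All parameters are fixed here: b is a lower bound for the exponent gained by smoothing,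
  q is the value that \<open>\<rho> powr b\<close> must reach, and \<rho> solves
  \<open>\<rho> powr b = q\<close>. The size 12K/\<rho> covers both the constructed junta and the
  small values of n.\<close>

lemma slice_junta_approx:
  fixes K \<delta> \<epsilon> :: real
  assumes K: "K \<ge> 1" and \<delta>: "0 < \<delta>" "\<delta> \<le> 1/2" and \<epsilon>: "0 < \<epsilon>" "\<epsilon> \<le> 1/2"
    and k: "0 < k" "k < n" "\<delta> \<le> real k / real n" "real k / real n \<le> 1 - \<delta>"
    and tot: "total_influence n k f \<le> K"
    and b: "b = \<delta> * \<epsilon> / (256 * K)"
    and q: "q = \<epsilon> ^ 3 / (1024 * K * (1 + 4 * K)\<^sup>2)"
    and \<rho>: "\<rho> = q powr (1 / b)"
  shows "\<exists>g. junta n k (12 * K / \<rho>) g \<and> L1_norm n k (\<lambda>x. f x - g x) \<le> \<epsilon>"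
proof -
  interpret slice_space "{1..n}" k using k by unfold_locales auto
  note [simp del] = One_nat_def
  have N: "real (card {1..n}) = real n" by simp
  have n0: "real n > 0" using k by simp
  have b0: "0 < b" using b \<delta> \<epsilon> K by simp
  have "\<delta> * \<epsilon> \<le> 1 * 1" using \<delta> \<epsilon> by (intro mult_mono) auto
  then have b1: "b \<le> 1" using b K by (simp add: divide_le_eq)
  have "1 * 1 \<le> 1024 * K * (1 + 4 * K)\<^sup>2"
    using K by (intro mult_mono one_le_power) auto
  then have den: "1024 * K * (1 + 4 * K)\<^sup>2 \<ge> 1" by simp
  have q0: "0 < q" using q \<epsilon> K by simp
  have q\<epsilon>: "q \<le> \<epsilon>"
  proof -
    have "q \<le> \<epsilon> ^ 3" using den \<epsilon> q by (simp add: divide_le_eq mult_le_cancel_left1)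
    also have "\<dots> \<le> \<epsilon>" using power_decreasing[of 1 3 \<epsilon>] \<epsilon> by simp
    finally show ?thesis .
  qed
  have \<rho>0: "0 < \<rho>" using \<rho> q0 by simp
  have \<rho>q: "\<rho> \<le> q"
    using powr_mono'[of 1 "1 / b" q] q0 q\<epsilon> \<epsilon> b0 b1 \<rho> by simp
  show ?thesis
  proof (cases "real n \<le> 12 * K / \<rho>")
    \<comment> \<open>With so few coordinates f itself is a junta, on all of
      \<open>{1..n}\<close>.\<close>
    case True
    have "junta n k (12 * K / \<rho>) f"
      unfolding junta_def depends_only_on_def using True by (intro exI[of _ "{1..n}"]) auto
    moreover have "L1_norm n k (\<lambda>x. f x - f x) \<le> \<epsilon>" using \<epsilon> by (simp add: L1_norm_def)
    ultimately show ?thesis by blast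
  next
    case False
    \<comment> \<open>The budget is \<epsilon> = 2(\<epsilon>/8 + \<epsilon>/4 + \<epsilon>/8) for
      smoothing, variance and rounding; this e makes \<open>2 * e * (1 + 4 * K)\<close> equal to
      \<epsilon>/8, and m below keeps m/n times K within \<epsilon>/8.\<close>
    define e where "e = \<epsilon> / (16 * (1 + 4 * K))"
    have e: "0 < e" "e \<le> 1" using \<epsilon> K by (auto simp: e_def divide_le_eq)
    define m where "m = nat \<lfloor>\<epsilon> * real n / (8 * K)\<rfloor>"
    \<comment> \<open>A lower bound for \<open>rate * m\<close>, namely the product of \<delta>/(8n)
      and \<epsilon>n/(16K). It equals 2b, because 1 - exp(-x) is estimated from below by x/2 on
      [0, 1].\<close>
    define x where "x = \<delta> * \<epsilon> / (128 * K)"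
    \<comment> \<open>Since n > 12K/\<rho> and \<rho> \<le> \<epsilon>, the number to be rounded
      down to m is at least 1, so rounding loses at most a factor 2.\<close>
    have large: "\<epsilon> * real n / (8 * K) \<ge> 1"
    proof -
      have "8 * K \<le> 12 * K * (\<epsilon> / \<rho>)"
        using \<rho>q q\<epsilon> \<rho>0 K mult_mono[of "8 * K" "12 * K" 1 "\<epsilon> / \<rho>"] by simp
      also have "\<dots> = \<epsilon> * (12 * K / \<rho>)" by simp
      also have "\<dots> \<le> \<epsilon> * real n" using False \<epsilon> by (intro mult_left_mono) auto
      finally show ?thesis using K by (simp add: le_divide_eq)
    qed
    have m_le: "real m \<le> \<epsilon> * real n / (8 * K)" and m_ge: "\<epsilon> * real n / (16 * K) \<le> real m"
    proof -
      define y where "y = \<epsilon> * real n / (8 * K)"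
      have "1 \<le> \<lfloor>y\<rfloor>" using large by (simp add: y_def le_floor_iff)
      then have "real m = of_int \<lfloor>y\<rfloor>" "1 \<le> real_of_int \<lfloor>y\<rfloor>" by (simp_all add: m_def y_def)
      then have "real m \<le> y" "y / 2 \<le> real m"
        using of_int_floor_le[of y] real_of_int_floor_add_one_gt[of y] by linarith+
      then show "real m \<le> \<epsilon> * real n / (8 * K)" "\<epsilon> * real n / (16 * K) \<le> real m"
        by (simp_all add: y_def)
    qed
    have lsc_le: "lsc \<le> 4 / \<delta>"
    proof -
      have kn: "\<delta> * real n \<le> real k" "\<delta> * real n \<le> real n - real k"
        using k n0 by (simp_all add: field_simps)
      then have "real n / real k \<le> 1 / \<delta>" "real n / (real n - real k) \<le> 1 / \<delta>"
        using \<delta> k by (simp_all add: field_simps)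
      moreover have "lsc = 2 * (real n / real k + real n / (real n - real k))"
        by (simp add: lsc_def)
      ultimately show ?thesis by simp
    qed
    have "rate \<ge> \<delta> / (8 * real n)"
    proof -
      have "2 * real n * lsc \<le> 2 * real n * (4 / \<delta>)" using lsc_le by (intro mult_left_mono) auto
      then have "1 / (2 * real n * (4 / \<delta>)) \<le> 1 / (2 * real n * lsc)"
        using lsc_ge n0 \<delta> by (intro divide_left_mono mult_pos_pos) auto
      then show ?thesis by (simp add: rate_def)
    qed
    then have "\<delta> / (8 * real n) * (\<epsilon> * real n / (16 * K)) \<le> rate * real m"
      using m_ge \<delta> \<epsilon> K rate_bounds by (intro mult_mono) auto
    then have x_le: "x \<le> rate * real m" using n0 by (simp add: x_def)
    have x01: "0 \<le> x" "x \<le> 1"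
      using \<delta> \<epsilon> K \<open>\<delta> * \<epsilon> \<le> 1 * 1\<close> by (auto simp: x_def divide_le_eq)
    have "(1 - rate) ^ m \<le> exp (- rate) ^ m"
      using rate_bounds exp_ge_add_one_self[of "- rate"] by (intro power_mono) auto
    also have "\<dots> = exp (- (rate * real m))" by (simp add: mult.commute flip: exp_of_nat_mult)
    also have "\<dots> \<le> exp (- x)" using x_le by simp
    also have "\<dots> \<le> 1 / (1 + x)"
      using exp_ge_add_one_self[of x] x01 by (simp add: exp_minus field_simps)
    also have "\<dots> \<le> 1 - x / 2"
      using x01 mult_left_le[of x x] by (simp add: field_simps)
    also have "x / 2 = b" by (simp add: x_def b)
    finally have b_le: "b \<le> 1 - (1 - rate) ^ m" by simp
    have "\<rho> powr (1 - (1 - rate) ^ m) \<le> \<rho> powr b"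
      using b_le \<rho>0 \<rho>q q\<epsilon> \<epsilon> by (intro powr_mono') auto
    also have "\<dots> = q" using b0 q0 by (simp add: \<rho> powr_powr)
    also have "q = \<epsilon> * e\<^sup>2 / (4 * K)"
    proof -
      have "\<epsilon> ^ 3 / (1024 * K * d\<^sup>2) = \<epsilon> * (\<epsilon> / (16 * d))\<^sup>2 / (4 * K)" for d :: real
        by (simp add: power2_eq_square power3_eq_cube mult_ac)
      then show ?thesis unfolding q e_def .
    qed
    finally have small: "\<rho> powr (1 - (1 - rate) ^ m) \<le> \<epsilon> * e\<^sup>2 / (4 * K)" .
    let ?h = "\<lambda>X. f (point_of n X)"
    have tot': "tot ?h \<le> K" using tot total_influence_eq[of k n f] k by simp
    obtain S H where S: "S \<subseteq> {1..n}" "real (card S) \<le> 6 * K / \<rho>" and dep: "depends_on S H"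
      and H: "E (\<lambda>X. \<bar>?h X - H X\<bar>)
        \<le> 2 * ((real m / real n + \<rho> powr (1 - (1 - rate) ^ m) / e\<^sup>2) * K + 2 * e * (1 + 4 * K))"
      using junta_approx[OF \<rho>0 _ e tot', of m] False by auto
    define g where "g x = H {i \<in> {1..n}. x i = (1::nat)}" for x
    have g: "g (point_of n X) = H X" if "X \<in> \<Omega>" for X
    proof -
      have "{i \<in> {1..n}. point_of n X i = 1} = X" using that by (auto simp: point_of_def ksub_def)
      then show ?thesis by (simp add: g_def)
    qed
    have "depends_only_on n k S g"
      unfolding depends_only_on_def
    proof (intro allI impI)
      fix i j assume ij: "1 \<le> i \<and> i < j \<and> j \<le> n \<and> i \<notin> S \<and> j \<notin> S"
      then have mem: "i \<in> {1..n}" "j \<in> {1..n}" by auto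
      have "influence n k i j g = E (\<lambda>X. \<bar>g (point_of n (sw i j X)) - g (point_of n X)\<bar>)"
        using influence_eq[OF mem, of k g] k by (simp add: infl_def D_def)
      also have "\<dots> = E (\<lambda>X. 0)"
      proof (rule E_cong)
        fix X assume X: "X \<in> \<Omega>"
        have "H (sw i j X) = H X" using dep ij mem by (simp add: depends_on_def)
        then show "\<bar>g (point_of n (sw i j X)) - g (point_of n X)\<bar> = 0"
          using g[OF X] g[OF sw_ksub[OF mem X]] by simp
      qed
      finally show "influence n k i j g = 0" by simp
    qed
    moreover have "6 * K / \<rho> \<le> 12 * K / \<rho>"
      using K \<rho>0 by (intro divide_right_mono) auto
    ultimately have "junta n k (12 * K / \<rho>) g"
      unfolding junta_def using S by (meson order_trans)
    moreover have "L1_norm n k (\<lambda>x. f x - g x) \<le> \<epsilon>"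
    proof -
      have "L1_norm n k (\<lambda>x. f x - g x) = E (\<lambda>X. \<bar>?h X - H X\<bar>)"
        unfolding L1_norm_eq E_def[symmetric] by (intro E_cong) (simp add: g)
      also note H
      also have "2 * ((real m / real n + \<rho> powr (1 - (1 - rate) ^ m) / e\<^sup>2) * K + 2 * e * (1 + 4 * K))
          \<le> 2 * ((\<epsilon> / (8 * K) + \<epsilon> / (4 * K)) * K + 2 * e * (1 + 4 * K))"
      proof -
        have "real m / real n \<le> \<epsilon> / (8 * K)" using m_le n0 by (simp add: field_simps)
        moreover have "\<rho> powr (1 - (1 - rate) ^ m) / e\<^sup>2 \<le> \<epsilon> / (4 * K)"
          using small e by (simp add: divide_le_eq)
        ultimately show ?thesis using K by (intro mult_left_mono add_mono mult_right_mono) auto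
      qed
      also have "\<dots> = \<epsilon>" using K by (simp add: e_def field_simps)
      finally show ?thesis .
    qed
    ultimately show ?thesis by blast
  qed
qed

theorem theorem4p4:
  fixes K \<delta> :: real
  assumes "K > 0" and "0 < \<delta>" and "\<delta> \<le> 1/2"
  shows "\<exists>C::real. C > 0 \<and>
    (\<forall>(n::nat) (k::nat) (f :: (nat \<Rightarrow> nat) \<Rightarrow> real).
       2 \<le> n \<longrightarrow> 1 \<le> k \<longrightarrow> k \<le> n - 1 \<longrightarrow>
       \<delta> \<le> real k / real n \<longrightarrow> real k / real n \<le> 1 - \<delta> \<longrightarrow>
       total_influence n k f \<le> K \<longrightarrow>
       (\<forall>\<epsilon>::real. 0 < \<epsilon> \<longrightarrow> \<epsilon> \<le> 1/2 \<longrightarrow>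
          (\<exists>g :: (nat \<Rightarrow> nat) \<Rightarrow> real.
             junta n k (exp (C * (\<bar>ln \<epsilon>\<bar> / \<epsilon>))) g \<and>
             L1_norm n k (\<lambda>x. f x - g x) \<le> \<epsilon>)))"
proof -
  define M where "M = max K 1"
  define c where "c = 1024 * M * (1 + 4 * M)\<^sup>2"
  \<comment> \<open>The logarithm of 12M/\<rho> is ln(12M) + 256M/(\<delta>\<epsilon>) * (3 |ln
    \<epsilon>| + ln c). As \<epsilon> \<le> 1/2 gives |ln \<epsilon>| \<ge> ln 2, dividing the
    constant terms by ln 2 lets them be absorbed into multiples of |ln
    \<epsilon>|/\<epsilon>.\<close>
  define C where "C = ln (12 * M) / ln 2 + 256 * M / \<delta> * (3 + ln c / ln 2)"
  have M: "M \<ge> 1" "K \<le> M" by (auto simp: M_def)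
  have "1 * 1 \<le> c"
    unfolding c_def using M by (intro mult_mono one_le_power) auto
  then have c1: "c \<ge> 1" by simp
  have ln_pos: "ln (12 * M) > 0" "ln c \<ge> 0" using M c1 by auto
  have "256 * M / \<delta> * (3 + ln c / ln 2) > 0"
    using M assms ln_pos by (intro mult_pos_pos add_pos_nonneg) auto
  then have C0: "C > 0" using ln_pos by (simp add: C_def add_pos_pos)
  have size: "12 * M / ((\<epsilon> ^ 3 / c) powr (1 / (\<delta> * \<epsilon> / (256 * M)))) \<le> exp (C * (\<bar>ln \<epsilon>\<bar> / \<epsilon>))"
    if \<epsilon>: "0 < \<epsilon>" "\<epsilon> \<le> 1/2" for \<epsilon> :: real
  proof -
    define l where "l = - ln \<epsilon>"
    have "ln \<epsilon> \<le> ln (1/2)" using \<epsilon> by simp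
    then have l2: "ln 2 \<le> l" by (simp add: l_def ln_div)
    have "0 < ln (2::real)" by simp
    with l2 have l0: "0 < l" by linarith
    have l\<epsilon>: "l \<le> l / \<epsilon>" using \<epsilon> l0 by (simp add: le_divide_eq)
    have "ln (12 * M / ((\<epsilon> ^ 3 / c) powr (1 / (\<delta> * \<epsilon> / (256 * M)))))
        = ln (12 * M) + 256 * M / \<delta> * (3 * l + ln c) / \<epsilon>"
      using \<epsilon> M c1 assms by (simp add: ln_div ln_powr ln_realpow l_def field_simps)
    also have "ln (12 * M) \<le> ln (12 * M) / ln 2 * (l / \<epsilon>)"
      using mult_left_mono[of "ln 2" "l / \<epsilon>" "ln (12 * M) / ln 2"] ln_pos l2 l\<epsilon> by simp
    also have "ln c \<le> ln c / ln 2 * l"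
      using mult_left_mono[of "ln 2" l "ln c / ln 2"] ln_pos l2 by simp
    also have "ln (12 * M) / ln 2 * (l / \<epsilon>) + 256 * M / \<delta> * (3 * l + ln c / ln 2 * l) / \<epsilon> = C * (l / \<epsilon>)"
      by (simp add: C_def algebra_simps add_divide_distrib)
    finally have "ln (12 * M / ((\<epsilon> ^ 3 / c) powr (1 / (\<delta> * \<epsilon> / (256 * M))))) \<le> C * (l / \<epsilon>)"
      using M assms \<epsilon> by (simp add: divide_right_mono mult_left_mono)
    moreover have "12 * M / ((\<epsilon> ^ 3 / c) powr (1 / (\<delta> * \<epsilon> / (256 * M)))) > 0"
      using \<epsilon> M c1 by simp
    moreover have "\<bar>ln \<epsilon>\<bar> = l" using l0 by (simp add: l_def)
    ultimately show ?thesis by (metis exp_le_cancel_iff exp_ln)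
  qed
  show ?thesis
  proof (intro exI[of _ C] conjI C0 allI impI)
    fix n k :: nat and f :: "(nat \<Rightarrow> nat) \<Rightarrow> real" and \<epsilon> :: real
    assume nk: "2 \<le> n" "1 \<le> k" "k \<le> n - 1" "\<delta> \<le> real k / real n" "real k / real n \<le> 1 - \<delta>"
      and "total_influence n k f \<le> K" and \<epsilon>: "0 < \<epsilon>" "\<epsilon> \<le> 1/2"
    then have "total_influence n k f \<le> M" "0 < k" "k < n" using M by auto
    then obtain g where g: "junta n k (12 * M / ((\<epsilon> ^ 3 / c) powr (1 / (\<delta> * \<epsilon> / (256 * M))))) g"
      "L1_norm n k (\<lambda>x. f x - g x) \<le> \<epsilon>"
      using slice_junta_approx[OF M(1) assms(2,3) \<epsilon> _ _ nk(4,5) _ refl refl refl] unfolding c_def by blast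
    have "junta n k (exp (C * (\<bar>ln \<epsilon>\<bar> / \<epsilon>))) g"
      using g(1) size[OF \<epsilon>] unfolding junta_def by (meson order_trans)
    then show "\<exists>g. junta n k (exp (C * (\<bar>ln \<epsilon>\<bar> / \<epsilon>))) g \<and> L1_norm n k (\<lambda>x. f x - g x) \<le> \<epsilon>"
      using g(2) by blast
  qed
qed

end
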